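(* Let $n\ge 2$, $G=\mathrm{Isom}(\mathbb{H}^n)$, $\Gamma\le G$ a lattice, $\mathcal{X}=\Gamma\backslash G$ with its $G$-invariant probability measure $\mu$. Let $\{g_m\}_{m\in\mathbb{Z}}\le G$ be a diagonalizable one parameter group, and let $\mathcal{B}=\{B_m\}_{m\in\mathbb{N}}$ be a regular family of shrinking targets in $\mathcal{X}$ (not necessarily spherical). Let $\mathcal{A}_{\rm ah}(\mathcal{B})$ be the set of $x\in\mathcal{X}$ such that $\{xg_k:k\le m\}\cap B_m\neq\emptyset$ for all sufficiently large $m$. If $$\sum_{j=1}^\infty\frac{|\log(\mu(B_{2^j}))|}{2^j\mu(B_{2^j})}<\infty,$$ then $\mathcal{A}_{\rm ah}(\mathcal{B})$ has full $\mu$-measure. If, in addition, $\mu(B_{2^j})\ll\mu(B_{2^{j+1}})$ (for all $j$), then for $\mu$-a.e. $x\in\mathcal{X}$, for all sufficiently large $m$, $$\#\{k\le m: xg_k\in B_m\}\asymp m\,\mu(B_m).$$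
   Context: $G=\mathrm{Isom}(\mathbb{H}^n)$ is identified with $\mathrm{SO}_0(n,1)$, the identity component of the group of real matrices preserving $x_1^2+\dots+x_n^2-x_{n+1}^2$; $K=\left\{\begin{pmatrix}k'&0\\0&1\end{pmatrix}:k'\in \mathrm{SO}(n)\right\}$, and $A=\{a_t:t\in\mathbb{R}\}$ with $a_t=\begin{pmatrix} I_{n-1}&0&0\\0&\cosh t&\sinh t\\0&\sinh t&\cosh t\end{pmatrix}$. A (discrete) one parameter group is a subgroup $\{g_m\}_{m\in\mathbb{Z}}\le G$ with $g_mg_{m'}=g_{m+m'}$, acting on $\mathcal{X}$ by right multiplication; it is diagonalizable (and unbounded) if $g_1=\tau^{-1}\tilde k a_c\tau$ for some $\tau\in G$, $c\ne0$ and $\tilde k\in K$ commuting with $A$. A family of shrinking targets is a sequence $\{B_m\}_{m\in\mathbb{N}}$ of measurable subsets of $\mathcal{X}$ with $B_{m+1}\subseteq B_m$ and $\mu(B_m)\to 0$. Sobolev norms: fix a basis $\mathscr{B}$ of the Lie algebra $\mathfrak{g}$ of $G$; for $\psi\in C^\infty(\Gamma\backslash G)$ let $\mathcal{S}_{p,d}(\psi)=\sum_{\mathrm{ord}(\mathscr{D})\le d}\|\mathscr{D}\psi\|_{L^p(\Gamma\backslash G)}$, where $\mathscr{D}$ ranges over monomials in $\mathscr{B}$ of order at most $d$ and $X\in\mathfrak{g}$ acts by $X\psi(g)=\frac{d}{dt}\psi(ge^{tX})|_{t=0}$. Let $\mathcal{S}=\mathcal{S}_{2,l}$, where $l\ge1$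 is a fixed integer (depending only on $G$ and $K$) for which the following known decay of matrix coefficients holds: there is $\alpha_0>0$ (depending on the spectral gap of $\Gamma$) such that for all smooth $\psi,\phi\in L^2(\Gamma\backslash G)$ orthogonal to constants, all $k_1,k_2\in K$ and $t\ge0$, $|\langle\pi(k_1a_tk_2)\psi,\phi\rangle|\ll\mathcal{S}_{2,l}(\psi)\mathcal{S}_{2,l}(\phi)e^{-\alpha_0t}$, with $\pi$ the right regular representation. A set $B\subseteq\mathcal{X}$ is $(c,\alpha)$-regular (for $\mathcal{S}$) if there are smooth functions $f^\pm$ with $0\le f^-\le\chi_B\le f^+\le1$, $c^{-1}\int f^+d\mu\le\mu(B)\le c\int f^-d\mu$, and $\mathcal{S}(f^\pm)\le c\,\mu(B)^{-\alpha}$. A family of sets is regular if there are $c>1$ and $\alpha\ge0$ such that all its members are $(c,\alpha)$-regular. $\mathbb{N}=\{1,2,\dots\}$; $k$ ranges over positive integers. $A\ll B$ means $A\le cB$ for a constant $c>0$; $A\asymp B$ means $A\ll B\ll A$; implied constants do not depend on $x$, $m$ or $j$. *)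

theory Defs
  imports "HOL-Probability.Probability_Measure" "HOL-Algebra.Coset"
begin

text \<open>
  Coordinates of \<open>\<real>\<^sup>n\<^sup>+\<^sup>1\<close> are indexed by \<open>'n option\<close> with \<open>n = CARD('n)\<close>: the indices
  \<open>Some i\<close> are the \<open>n\<close> spacelike coordinates (numbered by the linear order on \<open>'n\<close>, so that the
  \<open>n\<close>-th one is \<open>Some (Max UNIV)\<close>) and \<open>None\<close> is the last, timelike, coordinate.
\<close>

type_synonym 'n lmat = "real ^ ('n option) ^ ('n option)"

definition lorentz_form :: "real ^ ('n::finite option) \<Rightarrow> real" where
  "lorentz_form x = (\<Sum>i\<in>UNIV. (x $ Some i)\<^sup>2) - (x $ None)\<^sup>2"

definition O_n1 :: "('n::finite) lmat set" where
  "O_n1 = {A. \<forall>x. lorentz_form (A *v x) = lorentz_form x}"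

definition SO0 :: "('n::finite) lmat monoid" where
  "SO0 = \<lparr>carrier = connected_component_set O_n1 (mat 1), mult = (**), one = mat 1\<rparr>"

definition block_K :: "real ^ 'n ^ 'n \<Rightarrow> ('n::finite) lmat" where
  "block_K k = (\<chi> i j. case (i, j) of
      (Some a, Some b) \<Rightarrow> k $ a $ b
    | (None, None) \<Rightarrow> 1
    | _ \<Rightarrow> 0)"

definition max_compact :: "('n::finite) lmat set" where
  "max_compact = block_K ` {k. rotation_matrix k}"

definition a_mat :: "real \<Rightarrow> ('n::{finite,linorder}) lmat" where
  "a_mat t = (\<chi> i j.
     if i \<in> {Some (Max UNIV), None} \<and> j \<in> {Some (Max UNIV), None}
     then (if i = j then cosh t else sinh t)
     else (if i = j then 1 else 0))"

definition one_parameter_group :: "(int \<Rightarrow> ('n::finite) lmat) \<Rightarrow> bool" where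
  "one_parameter_group g \<longleftrightarrow>
     (\<forall>m. g m \<in> carrier SO0) \<and> (\<forall>m m'. g m ** g m' = g (m + m'))"

definition diagonalizable_group :: "(int \<Rightarrow> ('n::{finite,linorder}) lmat) \<Rightarrow> bool" where
  "diagonalizable_group g \<longleftrightarrow>
     (\<exists>\<tau>\<in>carrier SO0. \<exists>k\<in>max_compact. \<exists>c. c \<noteq> 0 \<and>
        (\<forall>t. k ** a_mat t = a_mat t ** k) \<and>
        g 1 = matrix_inv \<tau> ** k ** a_mat c ** \<tau>)"


text \<open>
  Points of \<open>\<Gamma>\<backslash>G\<close> are the cosets \<open>\<Gamma> #>\<^bsub>SO0\<^esub> g\<close>, and right multiplication by \<open>g\<close> is
  \<open>\<lambda>x. x #>\<^bsub>SO0\<^esub> g\<close>. A set of cosets is open in the quotient topology iff its union, which is its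
  preimage under the projection, is open in \<open>G\<close>.
\<close>

definition coset_opens :: "('n::finite) lmat set \<Rightarrow> 'n lmat set set set" where
  "coset_opens \<Gamma> =
     {U. U \<subseteq> rcosets\<^bsub>SO0\<^esub> \<Gamma> \<and> openin (top_of_set (carrier SO0)) (\<Union>U)}"

definition coset_borel :: "('n::finite) lmat set \<Rightarrow> 'n lmat set measure" where
  "coset_borel \<Gamma> = sigma (rcosets\<^bsub>SO0\<^esub> \<Gamma>) (coset_opens \<Gamma>)"

definition invariant_prob :: "('n::finite) lmat set \<Rightarrow> 'n lmat set measure \<Rightarrow> bool" where
  "invariant_prob \<Gamma> \<mu> \<longleftrightarrow>
     prob_space \<mu> \<and> space \<mu> = rcosets\<^bsub>SO0\<^esub> \<Gamma> \<and> sets \<mu> = sets (coset_borel \<Gamma>) \<and>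
     (\<forall>g\<in>carrier SO0. \<forall>E\<in>sets \<mu>. emeasure \<mu> ((\<lambda>x. x #>\<^bsub>SO0\<^esub> g) ` E) = emeasure \<mu> E)"

definition lattice_subgroup :: "('n::finite) lmat set \<Rightarrow> bool" where
  "lattice_subgroup \<Gamma> \<longleftrightarrow> subgroup \<Gamma> SO0 \<and> discrete \<Gamma> \<and> (\<exists>\<nu>. invariant_prob \<Gamma> \<nu>)"


definition mat_exp :: "real ^ 'm ^ 'm \<Rightarrow> real ^ 'm ^ 'm" where
  "mat_exp X = (\<Sum>k. (1 / fact k) *\<^sub>R ((((**) X) ^^ k) (mat 1)))"

definition lie_algebra :: "('n::finite) lmat set" where
  "lie_algebra = {X. \<forall>t. mat_exp (t *\<^sub>R X) \<in> carrier SO0}"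

definition lie_basis :: "('n::finite) lmat set \<Rightarrow> bool" where
  "lie_basis \<B> \<longleftrightarrow> independent \<B> \<and> span \<B> = lie_algebra"

text \<open>\<open>C\<^sup>k\<close> functions on a set \<open>U\<close>; only meaningful for open \<open>U\<close>.\<close>

primrec Ck_on :: "nat \<Rightarrow> 'a::euclidean_space set \<Rightarrow> ('a \<Rightarrow> 'b::real_normed_vector) \<Rightarrow> bool" where
  "Ck_on 0 U f \<longleftrightarrow> continuous_on U f"
| "Ck_on (Suc k) U f \<longleftrightarrow>
     (\<forall>x\<in>U. f differentiable (at x)) \<and>
     (\<forall>v. Ck_on k U (\<lambda>x. frechet_derivative f (at x) v))"

text \<open>
  Smoothness on an embedded submanifold \<open>S\<close> of a Euclidean space: locally, \<open>f\<close> is the restriction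
  of a smooth function on an open subset of the ambient space.
\<close>

definition smooth_on_submanifold ::
  "'a::euclidean_space set \<Rightarrow> ('a \<Rightarrow> 'b::real_normed_vector) \<Rightarrow> bool" where
  "smooth_on_submanifold S f \<longleftrightarrow>
     (\<forall>x\<in>S. \<exists>U F. open U \<and> x \<in> U \<and> (\<forall>k. Ck_on k U F) \<and> (\<forall>y\<in>U \<inter> S. F y = f y))"

definition smooth_coset_fun ::
  "('n::finite) lmat set \<Rightarrow> ('n lmat set \<Rightarrow> 'b::real_normed_vector) \<Rightarrow> bool" where
  "smooth_coset_fun \<Gamma> \<psi> \<longleftrightarrow>
     smooth_on_submanifold (carrier SO0) (\<lambda>g. \<psi> (\<Gamma> #>\<^bsub>SO0\<^esub> g))"

definition lie_deriv ::
  "('n::finite) lmat \<Rightarrow> ('n lmat set \<Rightarrow> 'b::real_normed_vector) \<Rightarrow> 'n lmat set \<Rightarrow> 'b" where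
  "lie_deriv X \<psi> = (\<lambda>x. vector_derivative (\<lambda>t. \<psi> (x #>\<^bsub>SO0\<^esub> mat_exp (t *\<^sub>R X))) (at 0))"

definition Lp_norm :: "'a measure \<Rightarrow> real \<Rightarrow> ('a \<Rightarrow> 'b::real_normed_vector) \<Rightarrow> ennreal" where
  "Lp_norm M p f =
     (if integrable M (\<lambda>x. norm (f x) powr p)
      then ennreal ((\<integral>x. norm (f x) powr p \<partial>M) powr (1 / p))
      else \<infinity>)"

text \<open>
  Monomials of order at most \<open>d\<close> are the (noncommutative) words of length at most \<open>d\<close> over the
  basis; the word \<open>[X\<^sub>1, \<dots>, X\<^sub>r]\<close> acts as \<open>X\<^sub>1 \<circ> \<dots> \<circ> X\<^sub>r\<close>.
\<close>

definition sobolev_norm ::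
  "('n::finite) lmat set measure \<Rightarrow> 'n lmat set \<Rightarrow> real \<Rightarrow> nat \<Rightarrow>
   ('n lmat set \<Rightarrow> 'b::real_normed_vector) \<Rightarrow> ennreal" where
  "sobolev_norm \<mu> \<B> p d \<psi> =
     (\<Sum>w\<in>{w. set w \<subseteq> \<B> \<and> length w \<le> d}. Lp_norm \<mu> p (foldr lie_deriv w \<psi>))"

definition matrix_coeff_decay ::
  "('n::{finite,linorder}) lmat set \<Rightarrow> 'n lmat set measure \<Rightarrow> 'n lmat set \<Rightarrow> nat \<Rightarrow> bool" where
  "matrix_coeff_decay \<Gamma> \<mu> \<B> l \<longleftrightarrow>
     (\<exists>\<alpha>\<^sub>0>0. \<exists>C>0. \<forall>\<psi> \<phi> :: 'n lmat set \<Rightarrow> complex.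
        smooth_coset_fun \<Gamma> \<psi> \<and> smooth_coset_fun \<Gamma> \<phi> \<and>
        integrable \<mu> (\<lambda>x. (norm (\<psi> x))\<^sup>2) \<and> integrable \<mu> (\<lambda>x. (norm (\<phi> x))\<^sup>2) \<and>
        (\<integral>x. \<psi> x \<partial>\<mu>) = 0 \<and> (\<integral>x. \<phi> x \<partial>\<mu>) = 0 \<longrightarrow>
        (\<forall>k\<^sub>1\<in>max_compact. \<forall>k\<^sub>2\<in>max_compact. \<forall>t\<ge>0.
           ennreal (norm (\<integral>x. \<psi> (x #>\<^bsub>SO0\<^esub> (k\<^sub>1 ** a_mat t ** k\<^sub>2)) * cnj (\<phi> x) \<partial>\<mu>))
           \<le> ennreal C * sobolev_norm \<mu> \<B> 2 l \<psi> * sobolev_norm \<mu> \<B> 2 l \<phi>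
              * ennreal (exp (- \<alpha>\<^sub>0 * t))))"


definition shrinking_targets :: "'a measure \<Rightarrow> (nat \<Rightarrow> 'a set) \<Rightarrow> bool" where
  "shrinking_targets \<mu> B \<longleftrightarrow>
     (\<forall>m\<ge>1. B m \<in> sets \<mu> \<and> B (m + 1) \<subseteq> B m) \<and> (\<lambda>m. measure \<mu> (B m)) \<longlonglongrightarrow> 0"

text \<open>
  The Sobolev bound is only meaningful for sets of positive measure, since \<open>0 powr (-\<alpha>) = 0\<close>.
\<close>

definition regular_set ::
  "('n::finite) lmat set \<Rightarrow> 'n lmat set measure \<Rightarrow> 'n lmat set \<Rightarrow> nat \<Rightarrow>
   real \<Rightarrow> real \<Rightarrow> 'n lmat set set \<Rightarrow> bool" where
  "regular_set \<Gamma> \<mu> \<B> l c \<alpha> E \<longleftrightarrow>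
     (\<exists>fm fp :: 'n lmat set \<Rightarrow> real.
        smooth_coset_fun \<Gamma> fm \<and> smooth_coset_fun \<Gamma> fp \<and>
        (\<forall>x\<in>space \<mu>. 0 \<le> fm x \<and> fm x \<le> indicator E x \<and> indicator E x \<le> fp x \<and> fp x \<le> 1) \<and>
        inverse c * (\<integral>x. fp x \<partial>\<mu>) \<le> measure \<mu> E \<and> measure \<mu> E \<le> c * (\<integral>x. fm x \<partial>\<mu>) \<and>
        sobolev_norm \<mu> \<B> 2 l fm \<le> ennreal (c * measure \<mu> E powr (- \<alpha>)) \<and>
        sobolev_norm \<mu> \<B> 2 l fp \<le> ennreal (c * measure \<mu> E powr (- \<alpha>)))"

definition regular_family ::
  "('n::finite) lmat set \<Rightarrow> 'n lmat set measure \<Rightarrow> 'n lmat set \<Rightarrow> nat \<Rightarrow>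
   (nat \<Rightarrow> 'n lmat set set) \<Rightarrow> bool" where
  "regular_family \<Gamma> \<mu> \<B> l B \<longleftrightarrow>
     (\<exists>c>1. \<exists>\<alpha>\<ge>0. \<forall>m\<ge>1. regular_set \<Gamma> \<mu> \<B> l c \<alpha> (B m))"

definition always_hitting ::
  "('n::finite) lmat set \<Rightarrow> (int \<Rightarrow> 'n lmat) \<Rightarrow> (nat \<Rightarrow> 'n lmat set set) \<Rightarrow> 'n lmat set set" where
  "always_hitting \<Gamma> g B =
     {x \<in> rcosets\<^bsub>SO0\<^esub> \<Gamma>. \<forall>\<^sub>F m in sequentially.
        {x #>\<^bsub>SO0\<^esub> g (int k) | k. 1 \<le> k \<and> k \<le> m} \<inter> B m \<noteq> {}}"

end

theory Submission
  imports Defs "HOL-Analysis.Analysis"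
begin

text \<open>
  Let \<open>f\<close> be one of the smooth functions \<open>f\<^sup>\<plusminus>\<close> approximating the indicator of \<open>B\<^sub>m\<close>, and
  \<open>u = \<mu>(B\<^sub>m)\<close>. By the Cartan decomposition \<open>g\<^sub>d = k\<^sub>1 a\<^sub>t k\<^sub>2\<close> with \<open>t\<close> growing linearly in \<open>d\<close>, so
  the decay of matrix coefficients bounds the correlation of \<open>f\<close> and \<open>f \<circ> g\<^sub>d\<close> by
  \<open>C u\<^sup>-\<^sup>2\<^sup>\<alpha> e\<^sup>-\<^sup>\<delta>\<^sup>d\<close>; trivially it is at most \<open>c u\<close>. Summing the smaller of the two bounds over \<open>d\<close>,
  the variance of \<open>\<Sum>\<^sub>k\<^sub>\<le>\<^sub>N f(x g\<^sub>k)\<close> is \<open>O(N u \<bar>ln u\<bar>)\<close>, so by Chebyshev this sum differs from its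
  mean, of order \<open>N u\<close>, by a constant factor only on a set of measure \<open>O(\<bar>ln u\<bar> / (N u))\<close>. With
  \<open>N = 2\<^sup>j\<close> and \<open>B\<^sub>m\<close> the targets at the dyadic scales \<open>2\<^sup>j\<close> and \<open>2\<^sup>j\<^sup>+\<^sup>1\<close> these measures are summable,
  and Borel--Cantelli applies; monotonicity of the targets interpolates between dyadic scales.
\<close>

section \<open>The Lorentz group and its Cartan decomposition\<close>

text \<open>The Cartan parameter t of \<open>g (int d)\<close> is not explicit:
  \<open>g (int d)\<close> is only conjugate to an element of K times a boost by d * c. Conjugation
  by a fixed \<tau> changes matrix entries by bounded factors, and after conjugation the time-time
  entry is exactly cosh (d * c); this forces t to be at least d * |c| minus a constant. Decay is
  available for mean-zero functions only, so f is replaced by f minus its mean. This does not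
  increase the Sobolev norm: Lie derivatives annihilate constants, and the variance is at most the
  second moment. The two correlation bounds cross at some d of order |ln u|. The exponent \<alpha>
  of the Sobolev loss enters only the constant in front of |ln u|, so every exponent leads to the
  same summability condition. Hitting needs nothing but a positive lower count. The doubling
  hypothesis serves to compare the measures of neighbouring dyadic targets with that of
  \<open>B m\<close>.\<close>

lemma continuous_on_matrix_mult [continuous_intros]:
  fixes f g :: "'a::topological_space \<Rightarrow> real^'n^'n"
  assumes "continuous_on S f" "continuous_on S g"
  shows "continuous_on S (\<lambda>x. f x ** g x)"
  unfolding matrix_matrix_mult_def
  by (intro continuous_intros assms)

text \<open>The polarization of \<open>lorentz_form\<close>. Membership in \<open>O_n1\<close>
  speaks of the quadratic form, while the arguments below need invariance for pairs of
  vectors.\<close>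

definition lorentz_prod :: "real ^ ('n::finite option) \<Rightarrow> real ^ ('n option) \<Rightarrow> real" where
  "lorentz_prod x y = (\<Sum>i\<in>UNIV. x $ Some i * y $ Some i) - x $ None * y $ None"

lemma lorentz_prod_polarization:
  "lorentz_prod x y = (lorentz_form (x + y) - lorentz_form x - lorentz_form y) / 2"
  by (simp add: lorentz_prod_def lorentz_form_def power2_eq_square sum.distrib sum_distrib_left
      algebra_simps sum_subtractf)

lemma lorentz_prod_O_n1:
  "A \<in> O_n1 \<Longrightarrow> lorentz_prod (A *v x) (A *v y) = lorentz_prod x y"
  by (simp add: lorentz_prod_polarization O_n1_def flip: matrix_vector_right_distrib)

lemma lorentz_prod_axis_Some: "lorentz_prod x (axis (Some i) 1) = x $ Some i"
  by (simp add: lorentz_prod_def axis_def sum.delta if_distrib cong: if_cong)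

lemma lorentz_prod_axis_None: "lorentz_prod x (axis None 1) = - x $ None"
  by (simp add: lorentz_prod_def axis_def)

text \<open>Nondegeneracy: a kernel vector is Lorentz-orthogonal to everything, and pairing it with
  the axis vectors returns its coordinates up to sign.\<close>

lemma O_n1_invertible: "A \<in> O_n1 \<Longrightarrow> invertible A"
proof -
  assume A: "A \<in> O_n1"
  have "x = 0" if "A *v x = 0" for x
  proof -
    have z: "lorentz_prod x y = 0" for y
      using lorentz_prod_O_n1[OF A, of x y] that by (simp add: lorentz_prod_def)
    have "x $ i = 0" for i
      using z[of "axis i 1"] by (cases i) (auto simp: lorentz_prod_axis_Some lorentz_prod_axis_None)
    then show ?thesis by (simp add: vec_eq_iff)
  qed
  then show ?thesis
    by (metis invertible_left_inverse matrix_left_invertible_ker)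
qed

lemma O_n1_mult: "A \<in> O_n1 \<Longrightarrow> B \<in> O_n1 \<Longrightarrow> A ** B \<in> O_n1"
  by (simp add: O_n1_def flip: matrix_vector_mul_assoc)

lemma O_n1_one: "mat 1 \<in> O_n1"
  by (simp add: O_n1_def)

lemma matrix_inv_invertible:
  fixes A :: "real^'n^'n"
  assumes "invertible A"
  shows "A ** matrix_inv A = mat 1" "matrix_inv A ** A = mat 1"
  using someI_ex[of "\<lambda>A'. A ** A' = mat 1 \<and> A' ** A = mat 1"] assms
  by (auto simp: matrix_inv_def invertible_def)

lemma O_n1_inv: "A \<in> O_n1 \<Longrightarrow> matrix_inv A \<in> O_n1"
proof -
  assume A: "A \<in> O_n1"
  have "lorentz_form (matrix_inv A *v x) = lorentz_form x" for x
  proof -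
    have "lorentz_form (A *v (matrix_inv A *v x)) = lorentz_form (matrix_inv A *v x)"
      using A by (simp add: O_n1_def)
    then show ?thesis
      using matrix_inv_invertible(1)[OF O_n1_invertible[OF A]]
      by (simp add: matrix_vector_mul_assoc)
  qed
  then show ?thesis by (simp add: O_n1_def)
qed

lemma carrier_SO0: "carrier SO0 = connected_component_set O_n1 (mat 1)"
  and mult_SO0 [simp]: "x \<otimes>\<^bsub>SO0\<^esub> y = x ** y"
  and one_SO0 [simp]: "\<one>\<^bsub>SO0\<^esub> = mat 1"
  by (simp_all add: SO0_def)

lemma SO0_subset: "carrier SO0 \<subseteq> O_n1"
  by (simp add: carrier_SO0 connected_component_subset)

lemma SO0_invertible: "A \<in> carrier SO0 \<Longrightarrow> invertible A"
  using O_n1_invertible SO0_subset by blast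

lemma SO0_one: "mat 1 \<in> carrier SO0"
  by (simp add: carrier_SO0 O_n1_one)

text \<open>The image of the component under left multiplication is a connected subset of
  \<open>O_n1\<close>, so it stays in the component as soon as one of its points does. With
  \<open>a\<close> the identity this gives products, with \<open>h\<close> the inverse of
  \<open>a\<close> it gives inverses.\<close>

lemma translate_SO0_subset:
  assumes "h \<in> O_n1" "a \<in> carrier SO0" "h ** a \<in> carrier SO0"
  shows "(**) h ` carrier SO0 \<subseteq> carrier SO0"
proof -
  have conn: "connected ((**) h ` carrier SO0)"
    by (intro connected_continuous_image continuous_intros)
       (auto simp: carrier_SO0 intro!: continuous_intros)
  have "(**) h ` carrier SO0 \<subseteq> connected_component_set O_n1 (h ** a)"
    using assms SO0_subset conn
    by (intro connected_component_maximal) (auto intro: O_n1_mult)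
  also have "connected_component_set O_n1 (h ** a) = carrier SO0"
    using assms(3) unfolding carrier_SO0 by (metis connected_component_eq)
  finally show ?thesis .
qed

lemma SO0_mult: "g \<in> carrier SO0 \<Longrightarrow> h \<in> carrier SO0 \<Longrightarrow> g ** h \<in> carrier SO0"
  using translate_SO0_subset[of g "mat 1"] SO0_subset SO0_one by auto

lemma SO0_inv: "g \<in> carrier SO0 \<Longrightarrow> matrix_inv g \<in> carrier SO0"
proof -
  assume g: "g \<in> carrier SO0"
  have "matrix_inv g ** g = mat 1" using matrix_inv_invertible SO0_invertible g by blast
  then have "(**) (matrix_inv g) ` carrier SO0 \<subseteq> carrier SO0"
    using translate_SO0_subset[of "matrix_inv g" g] g SO0_one SO0_subset O_n1_inv by auto
  then show ?thesis using SO0_one by force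
qed

lemma group_SO0: "group (SO0 :: ('n::finite) lmat monoid)"
proof (rule groupI)
  fix x :: "'n lmat" assume "x \<in> carrier SO0"
  then show "\<exists>y\<in>carrier SO0. y \<otimes>\<^bsub>SO0\<^esub> x = \<one>\<^bsub>SO0\<^esub>"
    using SO0_inv matrix_inv_invertible(2) SO0_invertible by (intro bexI[of _ "matrix_inv x"]) auto
qed (auto simp: matrix_mul_assoc SO0_mult SO0_one)

section \<open>Signs that are constant on the identity component\<close>

lemma connected_pos:
  fixes S :: "real set"
  assumes "connected S" "0 \<notin> S" "1 \<in> S" "x \<in> S"
  shows "x > 0"
  using connected_contains_Icc[OF assms(1,4,3)] assms(2) by (force simp: not_less subset_iff)

lemma SO0_det_pos:
  fixes g :: "('n::finite) lmat"
  assumes g: "g \<in> carrier SO0"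
  shows "det g > 0"
proof -
  have 1: "connected (det ` (carrier SO0 :: 'n lmat set))"
    unfolding det_def
    by (intro connected_continuous_image continuous_intros) (simp add: carrier_SO0)
  have 2: "det g \<in> det ` (carrier SO0 :: 'n lmat set)"
    using g by (rule imageI)
  have 3: "1 \<in> det ` (carrier SO0 :: 'n lmat set)"
    using SO0_one det_I by (metis image_eqI)
  have 4: "0 \<notin> det ` (carrier SO0 :: 'n lmat set)"
    using SO0_invertible invertible_det_nz by force
  show ?thesis
    by (rule connected_pos[OF 1 4 3 2])
qed

text \<open>The form takes the value -1 on the time axis, hence also on its image, the time column
  of \<open>g\<close>.\<close>

lemma O_n1_time_entry:
  fixes g :: "('n::finite) lmat"
  assumes g: "g \<in> O_n1"
  shows "(g $ None $ None)\<^sup>2 = 1 + (\<Sum>i\<in>UNIV. (g $ Some i $ None)\<^sup>2)"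
proof -
  have "lorentz_form (g *v axis None 1) = lorentz_form (axis None 1 :: real^'n option)"
    using g by (simp add: O_n1_def)
  then show ?thesis
    unfolding lorentz_form_def matrix_vector_mult_basis by (simp add: column_def axis_def)
qed

text \<open>By the preceding identity the entry has absolute value at least 1, so it cannot change
  sign on a connected group containing the identity.\<close>

lemma SO0_time_entry: "g \<in> carrier SO0 \<Longrightarrow> g $ None $ None \<ge> 1"
proof -
  assume g: "g \<in> carrier SO0"
  let ?f = "\<lambda>g::'a lmat. g $ None $ None"
  have sq: "(?f h)\<^sup>2 \<ge> 1" if "h \<in> carrier SO0" for h
    using O_n1_time_entry[of h] SO0_subset that by (auto simp: sum_nonneg)
  have "connected (?f ` (carrier SO0 :: 'a lmat set))"
    by (intro connected_continuous_image continuous_intros) (simp add: carrier_SO0)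
  moreover have "?f g \<in> ?f ` carrier SO0" "1 \<in> ?f ` (carrier SO0 :: 'a lmat set)"
    using g SO0_one by (force, force simp: mat_def)
  moreover have "0 \<notin> ?f ` (carrier SO0 :: 'a lmat set)"
    using sq by force
  ultimately have "?f g > 0"
    using connected_pos by blast
  with sq[OF g] show ?thesis
    using power2_le_imp_le[of 1 "?f g"] by simp
qed

section \<open>Block matrices, boosts and their determinants\<close>

lemma block_K_nth [simp]:
  "block_K P $ Some a $ Some b = P $ a $ b" "block_K P $ None $ None = 1"
  "block_K P $ Some a $ None = 0" "block_K P $ None $ Some b = 0"
  by (simp_all add: block_K_def)

lemma sum_option: "(\<Sum>i\<in>UNIV. f i) = f None + (\<Sum>i\<in>UNIV. f (Some i))"
  for f :: "'n::finite option \<Rightarrow> 'b::comm_monoid_add"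
  by (simp add: UNIV_option_conv sum.reindex)

lemma prod_option: "(\<Prod>i\<in>UNIV. f i) = f None * (\<Prod>i\<in>UNIV. f (Some i))"
  for f :: "'n::finite option \<Rightarrow> 'b::comm_monoid_mult"
  by (simp add: UNIV_option_conv prod.reindex)

lemma all_option: "(\<forall>i. Q i) \<longleftrightarrow> Q None \<and> (\<forall>i. Q (Some i))"
  by (metis option.exhaust)

lemma block_K_mult: "block_K P ** block_K Q = block_K (P ** Q)"
  by (simp add: vec_eq_iff matrix_matrix_mult_def all_option sum_option)

lemma block_K_one: "block_K (mat 1) = mat 1"
  by (simp add: vec_eq_iff mat_def all_option)

lemma map_permutation_Some:
  "map_permutation UNIV Some p (Some x) = Some (p x)" "map_permutation UNIV Some p None = None"
  by (simp_all add: map_permutation_def restrict_id_def)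

text \<open>Index set of the terms that survive when the determinant of \<open>block_K P\<close> is
  expanded over permutations: a permutation moving \<open>None\<close> picks up a zero
  entry.\<close>

lemma permutes_option_fixing_None:
  "bij_betw (map_permutation UNIV Some) {p. p permutes (UNIV :: 'n::finite set)}
     {q. q permutes UNIV \<and> q None = None}"
proof (rule bij_betw_byWitness[where f' = "\<lambda>q x. the (q (Some x))"])
  have fix_None: "\<exists>y. q (Some x) = Some y" if "q permutes UNIV" "q None = None"
    for q :: "'n option \<Rightarrow> 'n option" and x
    using that permutes_inj[OF that(1)] by (metis injD not_None_eq option.distinct(1))
  show "\<forall>a\<in>{p. p permutes (UNIV :: 'n set)}. (\<lambda>x. the (map_permutation UNIV Some a (Some x))) = a"
    by (simp add: map_permutation_Some)
  show "\<forall>q\<in>{q. q permutes UNIV \<and> q None = None}.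
     map_permutation UNIV Some (\<lambda>x. the (q (Some x))) = (q :: 'n option \<Rightarrow> 'n option)"
    using fix_None by (auto simp: fun_eq_iff all_option map_permutation_Some)
  have "map_permutation UNIV Some p permutes UNIV" if "p permutes UNIV" for p :: "'n \<Rightarrow> 'n"
    using map_permutation_permutes[OF _ that, of Some "range Some"]
    by (auto intro: permutes_subset simp: bij_betw_def)
  then show "map_permutation UNIV Some ` {p. p permutes (UNIV :: 'n set)}
      \<subseteq> {q. q permutes UNIV \<and> q None = None}"
    by (auto simp: map_permutation_Some)
  have "(\<lambda>x. the (q (Some x))) permutes UNIV" if q: "q permutes UNIV" "q None = None"
    for q :: "'n option \<Rightarrow> 'n option"
  proof -
    have "inj (\<lambda>x. the (q (Some x)))"
    proof (rule injI)
      fix x y assume "the (q (Some x)) = the (q (Some y))"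
      then have "q (Some x) = q (Some y)"
        using fix_None[OF q] by (metis option.sel)
      then show "x = y" using permutes_inj[OF q(1)] by (auto dest: injD)
    qed
    then show ?thesis
      by (intro bij_imp_permutes) (auto simp: bij_def finite_UNIV_inj_surj)
  qed
  then show "(\<lambda>q x. the (q (Some x))) ` {q. q permutes UNIV \<and> q None = None}
      \<subseteq> {p. p permutes (UNIV :: 'n set)}"
    by auto
qed

lemma det_block_K: "det (block_K P) = det P"
proof -
  let ?t = "\<lambda>q. of_int (sign q) * (\<Prod>i\<in>UNIV. block_K P $ i $ q i)"
  have "det (block_K P) = (\<Sum>q | q permutes UNIV \<and> q None = None. ?t q)"
    unfolding det_def
  proof (rule sum.mono_neutral_right)
    show "\<forall>q\<in>{q. q permutes UNIV} - {q. q permutes UNIV \<and> q None = None}. ?t q = 0"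
      by (auto simp: prod_option)
  qed (auto simp: finite_permutations)
  also have "\<dots> = (\<Sum>p | p permutes UNIV. ?t (map_permutation UNIV Some p))"
    by (rule sum.reindex_bij_betw[OF permutes_option_fixing_None, symmetric])
  also have "\<dots> = det P"
    unfolding det_def prod_option
    by (rule sum.cong) (auto simp: sign_map_permutation map_permutation_Some)
  finally show ?thesis .
qed

lemma a_mat_nth:
  "a_mat t $ i $ j =
     (if i \<in> {Some (Max UNIV), None} \<and> j \<in> {Some (Max UNIV), None}
     then (if i = j then cosh t else sinh t)
     else (if i = j then 1 else 0))"
  by (simp add: a_mat_def)

lemma a_mat_add: "a_mat s ** a_mat t = (a_mat (s + t) :: ('n::{finite,linorder}) lmat)"
proof -
  have Some_sum: "(\<Sum>i\<in>UNIV. f i) = f (Max UNIV) + (\<Sum>i\<in>UNIV - {Max UNIV}. f i)"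
    for f :: "'n \<Rightarrow> real"
    by (simp add: sum.remove)
  show ?thesis
    unfolding vec_eq_iff matrix_matrix_mult_def
    by (auto simp: a_mat_nth all_option sum_option Some_sum cosh_add sinh_add
        if_distrib[of "\<lambda>x. x * _"] if_distrib[of "\<lambda>x. _ * x"] sum.delta sum.delta' cong: if_cong)
qed

lemma a_mat_0: "a_mat 0 = mat 1"
  by (simp add: vec_eq_iff a_mat_nth mat_def)

text \<open>Halving \<open>t\<close> shows the determinant to be a square, and the inverse
  \<open>a_mat (- t)\<close> shows it to be nonzero.\<close>

lemma det_a_mat_pos: "det (a_mat t :: ('n::{finite,linorder}) lmat) > 0"
proof -
  let ?a = "a_mat :: real \<Rightarrow> 'n lmat"
  have "det (?a t) = det (?a (t/2)) * det (?a (t/2))"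
    by (simp add: a_mat_add flip: det_mul)
  moreover have "det (?a t) * det (?a (- t)) = 1"
    by (simp add: a_mat_add a_mat_0 flip: det_mul)
  ultimately show ?thesis
    by (cases "det (?a t) = 0") (auto simp: less_le)
qed

lemma matrix_mult_nth: "(A ** B) $ i $ j = (\<Sum>k\<in>UNIV. A $ i $ k * B $ k $ j)"
  by (simp add: matrix_matrix_mult_def)

lemma norm_axis_real: "norm (axis i x :: real^'n) = \<bar>x\<bar>"
  by (simp add: norm_eq_sqrt_inner inner_axis_axis)

lemma orthogonal_matrix_iff_norm:
  fixes P :: "real^'n^'n"
  shows "orthogonal_matrix P \<longleftrightarrow> (\<forall>v. norm (P *v v) = norm v)"
  using orthogonal_transformation_matrix[of "(*v) P"]
  by (simp add: orthogonal_transformation matrix_of_matrix_vector_mul)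

lemma block_K_O_n1: "orthogonal_matrix P \<Longrightarrow> block_K P \<in> O_n1"
proof -
  assume P: "orthogonal_matrix P"
  have "lorentz_form (block_K P *v x) = lorentz_form x" for x
  proof -
    define v where "v = (\<chi> i. x $ Some i)"
    have "norm (P *v v) = norm v"
      using P by (simp add: orthogonal_matrix_iff_norm)
    then have "(P *v v) \<bullet> (P *v v) = v \<bullet> v"
      by (simp add: norm_eq)
    then show ?thesis
      by (simp add: lorentz_form_def matrix_vector_mult_def sum_option v_def inner_vec_def power2_eq_square)
  qed
  then show ?thesis by (simp add: O_n1_def)
qed

lemma a_mat_O_n1: "a_mat t \<in> (O_n1 :: ('n::{finite,linorder}) lmat set)"
proof -
  have Some_sum: "(\<Sum>i\<in>UNIV. f i) = f (Max UNIV) + (\<Sum>i\<in>UNIV - {Max UNIV}. f i)"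
    for f :: "'n \<Rightarrow> real"
    by (simp add: sum.remove)
  have "lorentz_form (a_mat t *v x) = lorentz_form x" for x :: "real^'n option"
  proof -
    let ?u = "x $ Some (Max UNIV)" and ?v = "x $ None"
    have 1: "(a_mat t *v x) $ Some (Max UNIV) = cosh t * ?u + sinh t * ?v"
        "(a_mat t *v x) $ None = sinh t * ?u + cosh t * ?v"
      by (auto simp: matrix_vector_mult_def a_mat_nth sum_option Some_sum)
    have 2: "(a_mat t *v x) $ Some i = x $ Some i" if "i \<noteq> Max UNIV" for i
      using that by (auto simp: matrix_vector_mult_def a_mat_nth sum_option if_distrib[of "\<lambda>x. x * _"] cong: if_cong)
    have "(cosh t * ?u + sinh t * ?v)\<^sup>2 - (sinh t * ?u + cosh t * ?v)\<^sup>2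
        = ((cosh t)\<^sup>2 - (sinh t)\<^sup>2) * (?u\<^sup>2 - ?v\<^sup>2)"
      by algebra
    then have "(cosh t * ?u + sinh t * ?v)\<^sup>2 - (sinh t * ?u + cosh t * ?v)\<^sup>2 = ?u\<^sup>2 - ?v\<^sup>2"
      by (simp add: cosh_square_eq)
    then show ?thesis
      by (simp add: lorentz_form_def Some_sum 1 2)
  qed
  then show ?thesis by (simp add: O_n1_def)
qed

text \<open>The fixed axis settles the time column; invariance of the pairing with that axis then
  clears the time row. On the remaining spacelike block the form is the Euclidean one.\<close>

lemma O_n1_fixing_time_axis:
  fixes p :: "('n::finite) lmat"
  assumes p: "p \<in> O_n1" and fix_None: "p *v axis None 1 = axis None 1"
  shows "\<exists>P. orthogonal_matrix P \<and> p = block_K P"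
proof -
  let ?e = "axis None 1 :: real^'n option"
  have "column None p $ i = ?e $ i" for i
    using fix_None by (simp add: matrix_vector_mult_basis)
  then have col: "p $ i $ None = (if i = None then 1 else 0)" for i
    by (simp add: column_def axis_def)
  have row: "p $ None $ Some j = 0" for j
  proof -
    have "lorentz_prod (p *v axis (Some j) 1) ?e = lorentz_prod (axis (Some j) 1) ?e"
      using lorentz_prod_O_n1[OF p, of "axis (Some j) 1" ?e] unfolding fix_None .
    then show ?thesis
      unfolding lorentz_prod_axis_None matrix_vector_mult_basis by (simp add: column_def axis_def)
  qed
  define P where "P = (\<chi> i j. p $ Some i $ Some j)"
  have pP: "p = block_K P"
    by (simp add: vec_eq_iff all_option col row P_def)
  have "norm (P *v v) = norm v" for v
  proof -
    define x where "x = (\<chi> i. case i of None \<Rightarrow> 0 | Some a \<Rightarrow> v $ a)"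
    have "lorentz_form (block_K P *v x) = lorentz_form x"
      using p unfolding O_n1_def pP by simp
    then have "(P *v v) \<bullet> (P *v v) = v \<bullet> v"
      by (simp add: lorentz_form_def matrix_vector_mult_def sum_option x_def inner_vec_def power2_eq_square)
    then show ?thesis by (simp add: norm_eq)
  qed
  then have "orthogonal_matrix P"
    by (simp add: orthogonal_matrix_iff_norm)
  with pP show ?thesis by blast
qed

text \<open>The time column of \<open>g\<close> is (v, cosh t) with v of norm sinh t. Rotating the
  last spacelike axis onto v produces a rotation times a boost with the same time column, which
  differs from \<open>g\<close> on the right by a matrix fixing the time axis. The bound n \<ge> 2
  lets vectors of equal norm be matched by a map of determinant 1.\<close>

lemma SO0_cartan_decomposition:
  fixes g :: "('n::{finite,linorder}) lmat"
  assumes n: "CARD('n) \<ge> 2" and g: "g \<in> carrier SO0"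
  obtains k1 k2 t where "k1 \<in> max_compact" "k2 \<in> max_compact" "t \<ge> 0" "g = k1 ** a_mat t ** k2"
proof -
  define t where "t = arcosh (g $ None $ None)"
  have t: "t \<ge> 0" "cosh t = g $ None $ None"
    using SO0_time_entry[OF g] by (simp_all add: t_def)
  define v where "v = (\<chi> i. g $ Some i $ None)"
  have "(norm v)\<^sup>2 = (\<Sum>i\<in>UNIV. (g $ Some i $ None)\<^sup>2)"
    by (simp add: v_def norm_vec_def L2_set_def sum_nonneg)
  also have "\<dots> = (sinh t)\<^sup>2"
    using O_n1_time_entry[of g] g SO0_subset by (auto simp: sinh_square_eq t)
  finally have "norm v = norm (axis (Max UNIV) (sinh t) :: (real, 'n) vec)"
    using t(1) by (simp add: norm_axis_real power2_eq_iff_nonneg)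
  from rotation_exists[OF n this[symmetric]]
  obtain f where f: "orthogonal_transformation f" "det (matrix f) = 1"
      "f (axis (Max UNIV) (sinh t)) = v" .
  define R where "R = matrix f"
  have R: "rotation_matrix R" "R *v axis (Max UNIV) (sinh t) = v"
    using f by (auto simp: R_def rotation_matrix_def orthogonal_transformation_matrix)
  define h where "h = block_K R ** a_mat t"
  have h: "h \<in> O_n1"
    using R by (simp add: h_def O_n1_mult block_K_O_n1 a_mat_O_n1 rotation_matrix_def)
  define p where "p = matrix_inv h ** g"
  have hp: "g = h ** p"
    by (simp add: p_def matrix_mul_assoc matrix_inv_invertible O_n1_invertible h)
  have "h *v axis None 1 = g *v axis None 1"
  proof -
    have "(a_mat t :: 'n lmat) *v axis None 1 = (\<chi> i. case i of None \<Rightarrow> cosh t | Some a \<Rightarrow> axis (Max UNIV) (sinh t) $ a)"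
      unfolding matrix_vector_mult_basis
      by (simp add: column_def vec_eq_iff all_option a_mat_nth axis_def)
    moreover have "block_K R *v \<dots> = (\<chi> i. case i of None \<Rightarrow> cosh t | Some a \<Rightarrow> v $ a)"
      using R(2) by (simp add: vec_eq_iff all_option matrix_vector_mult_def sum_option)
    moreover have "\<dots> = g *v axis None 1"
      unfolding matrix_vector_mult_basis
      by (simp add: column_def vec_eq_iff all_option t v_def)
    ultimately show ?thesis
      by (simp add: h_def flip: matrix_vector_mul_assoc)
  qed
  then have "p *v axis None 1 = matrix_inv h *v (h *v axis None 1)"
    by (simp add: p_def flip: matrix_vector_mul_assoc)
  also have "\<dots> = axis None 1"
    by (simp add: matrix_vector_mul_assoc matrix_inv_invertible O_n1_invertible h)
  finally have "p *v axis None 1 = axis None 1" .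
  moreover have "p \<in> O_n1"
    using h g SO0_subset by (auto simp: p_def intro: O_n1_mult O_n1_inv)
  ultimately obtain P where P: "orthogonal_matrix P" "p = block_K P"
    using O_n1_fixing_time_axis by blast
  \<comment> \<open>So far the right factor is only orthogonal; the sign of the determinant makes it
    a rotation.\<close>
  have "det g = det (a_mat t :: 'n lmat) * det P"
    using R(1) by (simp add: hp h_def det_mul P det_block_K rotation_matrix_def)
  then have "det P > 0"
    using SO0_det_pos[OF g] det_a_mat_pos[of t, where 'n='n]
    by (simp add: zero_less_mult_iff)
  then have "rotation_matrix P"
    using P(1) det_orthogonal_matrix[OF P(1)] by (auto simp: rotation_matrix_def)
  then show thesis
    using that[of "block_K R" "block_K P" t] R(1) t(1) hp P(2)
    by (auto simp: max_compact_def h_def)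
qed

section \<open>Entrywise size of group elements\<close>

lemma cosh_le_exp: "t \<ge> 0 \<Longrightarrow> cosh t \<le> exp t" for t :: real
  by (simp add: cosh_def)

lemma exp_abs_le_cosh: "exp \<bar>t\<bar> \<le> 2 * cosh t" for t :: real
  by (simp add: cosh_def abs_if)

lemma max_compact_entry: "k \<in> max_compact \<Longrightarrow> \<bar>k $ i $ j\<bar> \<le> 1"
proof -
  assume "k \<in> max_compact"
  then obtain P where P: "orthogonal_matrix P" "k = block_K P"
    by (auto simp: max_compact_def rotation_matrix_def)
  have "\<bar>P $ a $ b\<bar> \<le> 1" for a b
  proof -
    have "P $ a $ b = (P *v axis b 1) $ a"
      by (simp add: matrix_vector_mult_basis column_def)
    also have "\<bar>\<dots>\<bar> \<le> norm (P *v axis b 1)"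
      by (rule component_le_norm_cart)
    also have "\<dots> = 1"
      using P(1) by (simp add: orthogonal_matrix_iff_norm norm_axis_real)
    finally show ?thesis .
  qed
  then show ?thesis by (cases i; cases j) (auto simp: P)
qed

lemma a_mat_entry: "\<bar>a_mat t $ i $ j\<bar> \<le> cosh t"
proof -
  have "\<bar>sinh t\<bar> \<le> cosh t" "1 \<le> cosh t"
    using cosh_real_ge_1[of t] sinh_less_cosh_real[of "t"] sinh_less_cosh_real[of "-t"]
    by (auto simp: abs_le_iff less_imp_le)
  then show ?thesis by (auto simp: a_mat_nth)
qed

lemma matrix_entry_le_norm:
  fixes A :: "real^'n^'m"
  shows "\<bar>A $ i $ j\<bar> \<le> norm A"
  using component_le_norm_cart[of "A $ i" j] Finite_Cartesian_Product.norm_nth_le[of A i] by linarith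

lemma matrix_mult_entry_bound:
  fixes A B :: "real^'m^'m"
  assumes "\<And>i j. \<bar>A $ i $ j\<bar> \<le> a" "\<And>i j. \<bar>B $ i $ j\<bar> \<le> b"
  shows "\<bar>(A ** B) $ i $ j\<bar> \<le> real CARD('m) * (a * b)"
proof -
  have "\<bar>(A ** B) $ i $ j\<bar> \<le> (\<Sum>k\<in>UNIV. \<bar>A $ i $ k * B $ k $ j\<bar>)"
    unfolding matrix_mult_nth by (rule sum_abs)
  also have "\<dots> \<le> (\<Sum>k\<in>(UNIV::'m set). a * b)"
  proof (rule sum_mono)
    fix k
    have "0 \<le> a" using assms(1)[of i k] by linarith
    then show "\<bar>A $ i $ k * B $ k $ j\<bar> \<le> a * b"
      unfolding abs_mult by (intro mult_mono assms) auto
  qed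
  finally show ?thesis by simp
qed

section \<open>Borel--Cantelli along dyadic scales\<close>

text \<open>After expanding the square, each fixed \<open>i\<close> meets every gap d at most twice,
  once on either side, and the bound depends on the gap alone. Pairs with i > j are covered by
  symmetry of the integrand.\<close>

lemma integral_square_sum_le:
  fixes X :: "nat \<Rightarrow> 'a \<Rightarrow> real"
  assumes int: "\<And>i j. integrable M (\<lambda>x. X i x * X j x)"
    and cov: "\<And>i j. 1 \<le> i \<Longrightarrow> i \<le> j \<Longrightarrow> \<bar>\<integral>x. X i x * X j x \<partial>M\<bar> \<le> b (j - i)"
    and b: "\<And>d. 0 \<le> b d"
  shows "(\<integral>x. (\<Sum>k=1..N. X k x)\<^sup>2 \<partial>M) \<le> 2 * real N * (\<Sum>d<N. b d)"
proof -
  have "(\<integral>x. (\<Sum>k=1..N. X k x)\<^sup>2 \<partial>M) = (\<Sum>i=1..N. \<Sum>j=1..N. \<integral>x. X i x * X j x \<partial>M)"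
    by (simp add: power2_eq_square sum_product int Bochner_Integration.integral_sum)
  also have "\<dots> \<le> (\<Sum>i=1..N. 2 * (\<Sum>d<N. b d))"
  proof (rule sum_mono)
    fix i assume i: "i \<in> {1..N}"
    have le: "(\<integral>x. X i x * X j x \<partial>M) \<le> (if j \<le> i then b (i - j) else b (j - i))"
      if "j \<in> {1..N}" for j
      using that i cov[of i j] cov[of j i] by (auto simp: mult.commute)
    have "(\<Sum>j=1..N. \<integral>x. X i x * X j x \<partial>M) \<le> (\<Sum>j=1..N. if j \<le> i then b (i - j) else b (j - i))"
      by (rule sum_mono[OF le])
    also have "\<dots> = (\<Sum>j\<in>{1..N} \<inter> {..i}. b (i - j)) + (\<Sum>j\<in>{1..N} \<inter> - {..i}. b (j - i))"
      by (subst sum.If_cases) (auto intro!: arg_cong2[where f="(+)"] sum.cong)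
    also have "(\<Sum>j\<in>{1..N} \<inter> {..i}. b (i - j)) = sum b ((\<lambda>j. i - j) ` ({1..N} \<inter> {..i}))"
      by (subst sum.reindex) (auto simp: inj_on_def)
    also have "\<dots> \<le> (\<Sum>d<N. b d)"
      using i by (intro sum_mono2) (auto simp: b)
    also have "(\<Sum>j\<in>{1..N} \<inter> - {..i}. b (j - i)) = sum b ((\<lambda>j. j - i) ` ({1..N} \<inter> - {..i}))"
      by (subst sum.reindex) (auto simp: inj_on_def)
    also have "\<dots> \<le> (\<Sum>d<N. b d)"
      using i by (intro sum_mono2) (auto simp: b)
    finally show "(\<Sum>j=1..N. \<integral>x. X i x * X j x \<partial>M) \<le> 2 * (\<Sum>d<N. b d)"
      by simp
  qed
  also have "\<dots> = 2 * real N * (\<Sum>d<N. b d)" by simp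
  finally show ?thesis .
qed

text \<open>
  The trivial bound is used for the first \<open>O(\<bar>ln u\<bar>)\<close> terms; this is the source of the
  logarithm in the summability condition.
\<close>

lemma sum_min_exp_decay_le:
  fixes u c C \<alpha> \<delta> :: real
  assumes u: "0 < u" "u \<le> exp (-1)" and c: "0 \<le> c" and C: "0 \<le> C" and \<alpha>: "0 \<le> \<alpha>" and \<delta>: "0 < \<delta>"
  shows "(\<Sum>d<N. min (c * u) (C * u powr (- 2 * \<alpha>) * exp (- \<delta> * real d)))
    \<le> (c * ((2 * \<alpha> + 1) / \<delta> + 1) + C / (1 - exp (- \<delta>))) * (u * \<bar>ln u\<bar>)"
proof -
  \<comment> \<open>Cutoff from which exp (- \<delta> * d) \<le> u^(2\<alpha> + 1), so that one
    factor u is left after cancelling u^(-2\<alpha>).\<close>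
  define L where "L = nat \<lceil>(2 * \<alpha> + 1) * \<bar>ln u\<bar> / \<delta>\<rceil>"
  \<comment> \<open>Thus |ln u| \<ge> 1, which absorbs the rounding in \<open>L\<close> and the
    constant from the geometric tail.\<close>
  have ln_u: "ln u \<le> -1"
    using u ln_mono[of u "exp (-1)"] by simp
  have L: "(2 * \<alpha> + 1) * \<bar>ln u\<bar> / \<delta> \<le> L" "L \<le> (2 * \<alpha> + 1) * \<bar>ln u\<bar> / \<delta> + 1"
    using \<alpha> \<delta> by (auto simp: L_def ceiling_correct nat_ceiling_le_eq of_nat_ceiling; linarith)+
  have "(2 * \<alpha> + 1) * \<bar>ln u\<bar> \<le> \<delta> * L"
    using L(1) \<delta> by (simp add: field_simps)
  then have "exp (- \<delta> * L) \<le> exp ((2 * \<alpha> + 1) * ln u)"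
    using ln_u by simp
  also have "\<dots> = u powr (2 * \<alpha>) * u"
    using u by (simp add: powr_def exp_add distrib_right)
  finally have expL: "u powr (- 2 * \<alpha>) * exp (- \<delta> * L) \<le> u"
    using u by (simp add: powr_minus field_simps)
  have geo: "(\<Sum>e<N. exp (- \<delta> * real e)) \<le> 1 / (1 - exp (- \<delta>))"
  proof -
    have "(\<Sum>e<N. exp (- \<delta> * real e)) = (\<Sum>e<N. exp (- \<delta>) ^ e)"
      by (simp add: exp_of_nat_mult[symmetric] mult.commute)
    also have "\<dots> = (1 - exp (- \<delta>) ^ N) / (1 - exp (- \<delta>))"
      using \<delta> by (simp add: sum_gp_strict)
    also have "\<dots> \<le> 1 / (1 - exp (- \<delta>))"
      using \<delta> by (intro divide_right_mono) auto
    finally show ?thesis .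
  qed
  let ?b = "\<lambda>d. min (c * u) (C * u powr (- 2 * \<alpha>) * exp (- \<delta> * real d))"
  \<comment> \<open>Lengthening the sum to L + N terms allows a split at \<open>L\<close> without
    comparing \<open>L\<close> with \<open>N\<close>.\<close>
  have "(\<Sum>d<N. ?b d) \<le> (\<Sum>d<L+N. ?b d)"
    using u c C by (intro sum_mono2) auto
  also have "\<dots> = (\<Sum>d<L. ?b d) + (\<Sum>e<N. ?b (L + e))"
    by (induction N) (simp_all add: algebra_simps)
  also have "\<dots> \<le> (\<Sum>d<L. c * u) + (\<Sum>e<N. C * u * exp (- \<delta> * real e))"
  proof (intro add_mono sum_mono)
    fix e
    have "exp (- \<delta> * real (L + e)) = exp (- \<delta> * L) * exp (- \<delta> * e)"
      by (simp add: algebra_simps flip: exp_add)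
    then have "?b (L + e) \<le> C * (u powr (- 2 * \<alpha>) * exp (- \<delta> * L)) * exp (- \<delta> * e)"
      by (simp add: mult.assoc)
    also have "\<dots> \<le> C * u * exp (- \<delta> * e)"
      using expL C by (intro mult_right_mono mult_left_mono) auto
    finally show "?b (L + e) \<le> C * u * exp (- \<delta> * real e)" .
  qed auto
  also have "\<dots> = L * (c * u) + C * u * (\<Sum>e<N. exp (- \<delta> * real e))"
    by (simp add: sum_distrib_left)
  also have "\<dots> \<le> (((2 * \<alpha> + 1) / \<delta> + 1) * \<bar>ln u\<bar>) * (c * u) + C * u * (1 / (1 - exp (- \<delta>)) * \<bar>ln u\<bar>)"
  proof (intro add_mono mult_right_mono mult_left_mono)
    show "real L \<le> ((2 * \<alpha> + 1) / \<delta> + 1) * \<bar>ln u\<bar>"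
      using L(2) ln_u by (simp add: algebra_simps)
    have "1 / (1 - exp (- \<delta>)) * 1 \<le> 1 / (1 - exp (- \<delta>)) * \<bar>ln u\<bar>"
      using ln_u \<delta> by (intro mult_left_mono) auto
    with geo show "(\<Sum>e<N. exp (- \<delta> * real e)) \<le> 1 / (1 - exp (- \<delta>)) * \<bar>ln u\<bar>"
      by linarith
  qed (use u c C in auto)
  finally show ?thesis by (simp add: algebra_simps)
qed

text \<open>Chebyshev's inequality, with the variance bounded through the correlations.
  \<open>u\<close> controls the correlations and \<open>a\<close> is the deviation per step;
  \<open>K\<close> depends on neither of them nor on \<open>N\<close>, so one constant serves all
  dyadic scales.\<close>

lemma (in prob_space) ergodic_sum_deviation:
  fixes f :: "'a \<Rightarrow> real"
  assumes S: "\<And>k. S k \<in> measurable M M" and f: "f \<in> borel_measurable M"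
    and bdd: "\<And>x. x \<in> space M \<Longrightarrow> 0 \<le> f x \<and> f x \<le> 1"
    and cov: "\<And>i j. 1 \<le> i \<Longrightarrow> i \<le> j \<Longrightarrow>
        \<bar>\<integral>x. (f (S i x) - m) * (f (S j x) - m) \<partial>M\<bar> \<le>
          min (c * u) (C * u powr (- 2 * \<alpha>) * exp (- \<delta> * real (j - i)))"
    and u: "0 < u" "u \<le> exp (-1)" and c: "0 \<le> c" and C: "0 \<le> C" and \<alpha>: "0 \<le> \<alpha>" and \<delta>: "0 < \<delta>"
    and K: "K = c * ((2 * \<alpha> + 1) / \<delta> + 1) + C / (1 - exp (- \<delta>))"
    and a: "a > 0" and N: "N > 0"
  shows "prob {x \<in> space M. real N * a \<le> \<bar>(\<Sum>k=1..N. f (S k x)) - real N * m\<bar>}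
    \<le> 2 * K * (u * \<bar>ln u\<bar>) / (real N * a\<^sup>2)"
proof -
  note [measurable] = S f
  have Sx: "S k x \<in> space M" if "x \<in> space M" for k x
    using that S by (auto simp: measurable_def)
  have bnd: "AE x in M. norm (f (S k x) - m) \<le> 1 + \<bar>m\<bar>" for k
  proof (rule AE_I2)
    fix x assume "x \<in> space M"
    then show "norm (f (S k x) - m) \<le> 1 + \<bar>m\<bar>"
      using bdd[OF Sx, of x k] by (simp add: abs_if)
  qed
  have "integrable M (\<lambda>x. (f (S i x) - m) * (f (S j x) - m))" for i j
  proof (rule integrable_const_bound[where B = "(1 + \<bar>m\<bar>) * (1 + \<bar>m\<bar>)"])
    show "AE x in M. norm ((f (S i x) - m) * (f (S j x) - m)) \<le> (1 + \<bar>m\<bar>) * (1 + \<bar>m\<bar>)"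
      using bnd[of i] bnd[of j] by eventually_elim (auto simp: abs_mult intro!: mult_mono)
  qed simp
  then have "(\<integral>x. (\<Sum>k=1..N. f (S k x) - m)\<^sup>2 \<partial>M)
      \<le> 2 * real N * (\<Sum>d<N. min (c * u) (C * u powr (- 2 * \<alpha>) * exp (- \<delta> * real d)))"
    by (rule integral_square_sum_le[where X = "\<lambda>k x. f (S k x) - m"]) (use u c C cov in auto)
  also have "\<dots> \<le> 2 * real N * (K * (u * \<bar>ln u\<bar>))"
    unfolding K by (intro mult_left_mono sum_min_exp_decay_le u c C \<alpha> \<delta>) auto
  finally have var: "(\<integral>x. (\<Sum>k=1..N. f (S k x) - m)\<^sup>2 \<partial>M) \<le> 2 * real N * (K * (u * \<bar>ln u\<bar>))" .
  have eq: "(\<Sum>k=1..N. f (S k x) - m) = (\<Sum>k=1..N. f (S k x)) - real N * m" for x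
    by (simp add: sum_subtractf)
  have "prob {x \<in> space M. real N * a \<le> \<bar>(\<Sum>k=1..N. f (S k x) - m)\<bar>}
      \<le> (\<integral>x. (\<Sum>k=1..N. f (S k x) - m)\<^sup>2 \<partial>M) / (real N * a)\<^sup>2"
  proof (rule second_moment_method)
    show "integrable M (\<lambda>x. (\<Sum>k=1..N. f (S k x) - m)\<^sup>2)"
    proof (rule integrable_const_bound[where B = "(real N * (1 + \<bar>m\<bar>))\<^sup>2"])
      have "AE x in M. \<forall>k\<in>{1..N}. norm (f (S k x) - m) \<le> 1 + \<bar>m\<bar>"
        using bnd by (simp add: AE_ball_countable)
      then show "AE x in M. norm ((\<Sum>k=1..N. f (S k x) - m)\<^sup>2) \<le> (real N * (1 + \<bar>m\<bar>))\<^sup>2"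
      proof eventually_elim
        case (elim x)
        have "\<bar>\<Sum>k=1..N. f (S k x) - m\<bar> \<le> (\<Sum>k=1..N. \<bar>f (S k x) - m\<bar>)"
          by (rule sum_abs)
        also have "\<dots> \<le> (\<Sum>k=1..N. 1 + \<bar>m\<bar>)"
          using elim by (intro sum_mono) auto
        finally show ?case
          by (simp add: abs_le_square_iff[symmetric] algebra_simps)
      qed
    qed simp
  qed (use a N in auto)
  also have "\<dots> \<le> 2 * real N * (K * (u * \<bar>ln u\<bar>)) / (real N * a)\<^sup>2"
    using var by (intro divide_right_mono) auto
  also have "\<dots> = 2 * K * (u * \<bar>ln u\<bar>) / (real N * a\<^sup>2)"
    using N by (simp add: power2_eq_square mult_ac)
  finally show ?thesis unfolding eq .
qed

text \<open>The short time 2^j is paired with the smaller target and the long time 2^(j+1) with the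
  larger one, so that the two counts enclose those at all times in between. Below, the mean gives a
  factor 1/c, halved by the permitted deviation; above, the mean contributes c and the deviation
  another c.\<close>

lemma (in prob_space) shrinking_target_hits:
  fixes S :: "nat \<Rightarrow> 'a \<Rightarrow> 'a" and B :: "nat \<Rightarrow> 'a set" and fm fp :: "nat \<Rightarrow> 'a \<Rightarrow> real"
  assumes S: "\<And>k. S k \<in> measurable M M"
    and targets: "shrinking_targets M B"
    and pos: "\<And>m. 1 \<le> m \<Longrightarrow> prob (B m) > 0"
    and fm: "\<And>m. 1 \<le> m \<Longrightarrow> fm m \<in> borel_measurable M"
    and fp: "\<And>m. 1 \<le> m \<Longrightarrow> fp m \<in> borel_measurable M"
    and sandwich: "\<And>m x. 1 \<le> m \<Longrightarrow> x \<in> space M \<Longrightarrow>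
      0 \<le> fm m x \<and> fm m x \<le> indicator (B m) x \<and> indicator (B m) x \<le> fp m x \<and> fp m x \<le> 1"
    and mean: "\<And>m. 1 \<le> m \<Longrightarrow> expectation (fp m) \<le> c * prob (B m) \<and> prob (B m) \<le> c * expectation (fm m)"
    and cov: "\<And>m f i j. 1 \<le> m \<Longrightarrow> f \<in> {fm m, fp m} \<Longrightarrow> 1 \<le> i \<Longrightarrow> i \<le> j \<Longrightarrow>
        \<bar>\<integral>x. (f (S i x) - expectation f) * (f (S j x) - expectation f) \<partial>M\<bar> \<le>
          min (c * prob (B m)) (C * prob (B m) powr (- 2 * \<alpha>) * exp (- \<delta> * real (j - i)))"
    and c: "1 < c" and C: "0 \<le> C" and \<alpha>: "0 \<le> \<alpha>" and \<delta>: "0 < \<delta>"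
    and summ: "(\<lambda>j. \<bar>ln (prob (B (2 ^ j)))\<bar> / (2 ^ j * prob (B (2 ^ j)))) summable_on {1..}"
  shows "AE x in M. \<forall>\<^sub>F j in sequentially.
      2 ^ j * prob (B (2 ^ (j + 1))) / (2 * c) \<le> real (card {k. 1 \<le> k \<and> k \<le> 2 ^ j \<and> S k x \<in> B (2 ^ (j + 1))}) \<and>
      real (card {k. 1 \<le> k \<and> k \<le> 2 ^ (j + 1) \<and> S k x \<in> B (2 ^ j)}) \<le> 2 ^ (j + 1) * (2 * c * prob (B (2 ^ j)))"
proof -
  define u where "u j = prob (B (2 ^ j))" for j
  define s where "s j = \<bar>ln (u j)\<bar> / (2 ^ j * u j)" for j
  define K where "K = c * ((2 * \<alpha> + 1) / \<delta> + 1) + C / (1 - exp (- \<delta>))"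
  have K: "K \<ge> 0" using c C \<alpha> \<delta> by (auto simp: K_def)
  have u_pos: "u j > 0" for j by (simp add: u_def pos)
  have u_lim: "u \<longlonglongrightarrow> 0"
  proof -
    have "filterlim (\<lambda>j. 2 ^ j :: nat) sequentially sequentially"
      by (rule filterlim_subseq) (simp add: strict_mono_def)
    moreover have "(\<lambda>m. prob (B m)) \<longlonglongrightarrow> 0" using targets by (simp add: shrinking_targets_def)
    ultimately show ?thesis unfolding u_def by (rule filterlim_compose[rotated])
  qed
  then have u_small: "\<forall>\<^sub>F j in sequentially. u j < exp (-1)"
    by (rule order_tendstoD) simp
  \<comment> \<open>The hypothesis sums over j \<ge> 1, hence the shift of the index; it also suits
    the lower count, whose target has index 2^(j+1).\<close>
  have sum_s: "summable (\<lambda>j. s (j + 1))"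
  proof -
    have "range Suc = {1..}"
      by (auto simp: image_iff Suc_le_eq gr0_conv_Suc)
    moreover have "s summable_on {1..}"
      using summ by (simp add: s_def[abs_def] u_def)
    ultimately have "(\<lambda>j. s (Suc j)) summable_on UNIV"
      using summable_on_reindex[of Suc UNIV s] by (simp add: o_def)
    then show ?thesis by (simp add: summable_on_imp_summable)
  qed
  have Sx: "S k x \<in> space M" if "x \<in> space M" for k x
    using that S by (auto simp: measurable_def)
  note [measurable] = S
  have two_pow: "1 \<le> (2::nat) ^ j" for j by simp
  note [measurable] = fm[OF two_pow] fp[OF two_pow]
  have bdd: "0 \<le> f x \<and> f x \<le> 1" if "x \<in> space M" "f \<in> {fm (2 ^ j), fp (2 ^ j)}" for f x j
    using sandwich[OF two_pow that(1), of j] that(2) by (auto simp: indicator_def split: if_splits)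

  define EL where "EL j = expectation (fm (2 ^ (j + 1)))" for j
  define EU where "EU j = expectation (fp (2 ^ j))" for j
  define L where "L j = {x \<in> space M. real (2 ^ j) * (EL j / 2) \<le>
      \<bar>(\<Sum>k=1..2 ^ j. fm (2 ^ (j + 1)) (S k x)) - real (2 ^ j) * EL j\<bar>}" for j
  define U where "U j = {x \<in> space M. real (2 ^ (j + 1)) * (c * u j) \<le>
      \<bar>(\<Sum>k=1..2 ^ (j + 1). fp (2 ^ j) (S k x)) - real (2 ^ (j + 1)) * EU j\<bar>}" for j
  have EL: "u (j + 1) / c \<le> EL j" for j
    using mean[of "2 ^ (j + 1)"] c by (simp add: EL_def u_def field_simps)
  then have EL_pos: "EL j > 0" for j
    using u_pos[of "j + 1"] c by (smt (verit) divide_pos_pos)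
  have EU: "EU j \<le> c * u j" for j
    using mean[of "2 ^ j"] by (simp add: EU_def u_def)
  have L_meas: "L j \<in> sets M" and U_meas: "U j \<in> sets M" for j
    unfolding L_def U_def by measurable

  have "\<forall>\<^sub>F j in sequentially. u (j + 1) < exp (-1)"
    using u_small by (rule eventually_all_ge_at_top[THEN eventually_mono]) auto
  then have "\<forall>\<^sub>F j in sequentially. norm (prob (L j)) \<le> 16 * K * c\<^sup>2 * s (j + 1)"
  proof eventually_elim
    case (elim j)
    let ?u = "u (j + 1)"
    have "prob (L j) \<le> 2 * K * (?u * \<bar>ln ?u\<bar>) / (real (2 ^ j) * (EL j / 2)\<^sup>2)"
      unfolding L_def EL_def u_def
      by (rule ergodic_sum_deviation[where c = c and C = C and \<alpha> = \<alpha> and \<delta> = \<delta>, OF S _ _ cov])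
         (use elim c C \<alpha> \<delta> EL_pos[of j] u_pos[of "j + 1"] fm[of "2 ^ (j + 1)"]
          bdd[of _ "fm (2 ^ (j + 1))" "j + 1"] in \<open>auto simp: K_def EL_def u_def\<close>)
    also have "\<dots> \<le> 2 * K * (?u * \<bar>ln ?u\<bar>) / (real (2 ^ j) * (?u / c / 2)\<^sup>2)"
      using K u_pos[of "j + 1"] c EL[of j] EL_pos[of j]
      by (intro divide_left_mono mult_left_mono power_mono divide_right_mono) auto
    \<comment> \<open>16 = 2 * 4 * 2: the variance constant, the square of the half in the
      deviation, and the change from 2^j to 2^(j+1).\<close>
    also have "\<dots> = 16 * K * c\<^sup>2 * s (j + 1)"
      using u_pos[of "j + 1"] c by (simp add: s_def field_simps power2_eq_square)
    finally show ?case by simp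
  qed
  then have sum_L: "summable (\<lambda>j. prob (L j))"
    by (rule summable_comparison_test_ev) (intro summable_mult sum_s)

  from u_small have "\<forall>\<^sub>F j in sequentially. norm (prob (U j)) \<le> K * s j"
  proof eventually_elim
    case (elim j)
    let ?u = "u j"
    have "prob (U j) \<le> 2 * K * (?u * \<bar>ln ?u\<bar>) / (real (2 ^ (j + 1)) * (c * ?u)\<^sup>2)"
      unfolding U_def EU_def u_def
      by (rule ergodic_sum_deviation[where c = c and C = C and \<alpha> = \<alpha> and \<delta> = \<delta>, OF S _ _ cov])
         (use elim c C \<alpha> \<delta> u_pos[of j] fp[of "2 ^ j"] bdd[of _ "fp (2 ^ j)" j] in \<open>auto simp: K_def EU_def u_def\<close>)
    also have "\<dots> \<le> 2 * K * (?u * \<bar>ln ?u\<bar>) / (real (2 ^ (j + 1)) * (1 * ?u)\<^sup>2)"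
      using K u_pos[of j] c
      by (intro divide_left_mono mult_left_mono power_mono mult_right_mono) auto
    also have "\<dots> = K * s j"
      using u_pos[of j] by (simp add: s_def field_simps power2_eq_square)
    finally show ?case by simp
  qed
  then have sum_U: "summable (\<lambda>j. prob (U j))"
    by (rule summable_comparison_test_ev)
       (use sum_s in \<open>simp add: summable_mult summable_Suc_iff\<close>)

  have "AE x in M. \<forall>\<^sub>F j in sequentially. x \<in> space M - L j"
    using L_meas sum_L by (intro borel_cantelli_AE1) (auto simp: emeasure_eq_measure)
  moreover have "AE x in M. \<forall>\<^sub>F j in sequentially. x \<in> space M - U j"
    using U_meas sum_U by (intro borel_cantelli_AE1) (auto simp: emeasure_eq_measure)
  ultimately show ?thesis
  proof eventually_elim
    case (elim x)
    have count: "real (card {k. 1 \<le> k \<and> k \<le> N \<and> S k x \<in> E}) = (\<Sum>k=1..N. indicator E (S k x))"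
      for N E
      by (simp add: indicator_def sum.If_cases if_distrib[of real] cong: if_cong)
         (auto intro!: arg_cong[where f=card])
    from elim show ?case
    proof eventually_elim
      case (elim j)
      then have x: "x \<in> space M" by simp
      have "\<bar>(\<Sum>k=1..2 ^ j. fm (2 ^ (j + 1)) (S k x)) - real (2 ^ j) * EL j\<bar> < real (2 ^ j) * (EL j / 2)"
        using elim(1) unfolding L_def by (simp only: Diff_iff mem_Collect_eq flip: not_le) blast
      then have "real (2 ^ j) * (EL j / 2) \<le> (\<Sum>k=1..2 ^ j. fm (2 ^ (j + 1)) (S k x))"
        by argo
      also have "\<dots> \<le> real (card {k. 1 \<le> k \<and> k \<le> 2 ^ j \<and> S k x \<in> B (2 ^ (j + 1))})"
        unfolding count using sandwich[OF two_pow Sx[OF x]] by (intro sum_mono) blast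
      finally have 1: "2 ^ j * (u (j + 1) / c) / 2
          \<le> real (card {k. 1 \<le> k \<and> k \<le> 2 ^ j \<and> S k x \<in> B (2 ^ (j + 1))})"
        using mult_left_mono[OF EL[of j], of "2 ^ j"] by simp
      have "real (card {k. 1 \<le> k \<and> k \<le> 2 ^ (j + 1) \<and> S k x \<in> B (2 ^ j)})
          \<le> (\<Sum>k=1..2 ^ (j + 1). fp (2 ^ j) (S k x))"
        unfolding count using sandwich[OF two_pow Sx[OF x]] by (intro sum_mono) blast
      also have "\<dots> \<le> real (2 ^ (j + 1)) * EU j + real (2 ^ (j + 1)) * (c * u j)"
      proof -
        have "\<bar>(\<Sum>k=1..2 ^ (j + 1). fp (2 ^ j) (S k x)) - real (2 ^ (j + 1)) * EU j\<bar>
            < real (2 ^ (j + 1)) * (c * u j)"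
          using elim(2) unfolding U_def by (simp only: Diff_iff mem_Collect_eq flip: not_le) blast
        then show ?thesis by argo
      qed
      also have "\<dots> \<le> 2 ^ (j + 1) * (2 * c * u j)"
        using mult_left_mono[OF EU[of j], of "2 ^ (j + 1)"] by simp
      finally show ?case using 1 by (simp add: u_def field_simps)
    qed
  qed
qed

section \<open>From dyadic scales to all times\<close>

lemma eventually_dyadic:
  assumes "\<forall>\<^sub>F j in sequentially. P j"
  shows "\<forall>\<^sub>F m in sequentially. \<exists>j\<ge>1. P j \<and> 2 ^ j \<le> m \<and> m \<le> (2::nat) ^ (j + 1)"
proof -
  obtain N where N: "\<And>j. j \<ge> N \<Longrightarrow> P j"
    using assms by (auto simp: eventually_sequentially)
  have "\<exists>j\<ge>1. P j \<and> 2 ^ j \<le> m \<and> m \<le> 2 ^ (j + 1)" if m: "m \<ge> 2 ^ (N + 1)" for m :: nat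
  proof -
    have "1 \<le> m" using m one_le_power[of "2::nat" "N + 1"] by linarith
    then obtain j where j: "2 ^ j \<le> m" "m < 2 ^ (j + 1)"
      using ex_power_ivl1[of 2 m] by auto
    \<comment> \<open>Starting at 2^(N+1) instead of 2^N makes j strictly larger than
      \<open>N\<close>, hence j \<ge> 1, where the doubling hypothesis begins.\<close>
    have "(2::nat) ^ (N + 1) < 2 ^ (j + 1)" using m j by linarith
    then have "N < j" by (simp only: power_strict_increasing_iff[of "2::nat"])
    then show ?thesis using j N[of j] by (intro exI[of _ j]) auto
  qed
  then show ?thesis by (auto simp: eventually_sequentially)
qed

lemma shrinking_targets_antimono:
  assumes "shrinking_targets M B" "1 \<le> m" "m \<le> m'"
  shows "B m' \<subseteq> B m"
  using assms(3)
proof (induction rule: dec_induct)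
  case (step k)
  then have "B (Suc k) \<subseteq> B k" using assms(1,2) by (simp add: shrinking_targets_def)
  with step show ?case by blast
qed simp

text \<open>For 2^j \<le> m \<le> 2^(j+1) the number of hits of \<open>B m\<close> up to time
  \<open>m\<close> lies between the two dyadic counts. The factor 4 * c * D collects 2 * c from
  these counts, 2 from the ratio of consecutive powers, and \<open>D\<close> from the
  measures.\<close>

lemma (in prob_space) dyadic_hits_imp_hits:
  fixes S :: "nat \<Rightarrow> 'a \<Rightarrow> 'a" and B :: "nat \<Rightarrow> 'a set"
  assumes targets: "shrinking_targets M B"
    and pos: "\<And>m. 1 \<le> m \<Longrightarrow> prob (B m) > 0"
    and c: "1 < c"
    and hits: "AE x in M. \<forall>\<^sub>F j in sequentially.
      2 ^ j * prob (B (2 ^ (j + 1))) / (2 * c) \<le> real (card {k. 1 \<le> k \<and> k \<le> 2 ^ j \<and> S k x \<in> B (2 ^ (j + 1))}) \<and>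
      real (card {k. 1 \<le> k \<and> k \<le> 2 ^ (j + 1) \<and> S k x \<in> B (2 ^ j)}) \<le> 2 ^ (j + 1) * (2 * c * prob (B (2 ^ j)))"
  shows "AE x in M. \<forall>\<^sub>F m in sequentially. \<exists>k. 1 \<le> k \<and> k \<le> m \<and> S k x \<in> B m"
    and "0 < D \<Longrightarrow> \<forall>j\<ge>1. prob (B (2 ^ j)) \<le> D * prob (B (2 ^ (j + 1))) \<Longrightarrow>
      AE x in M. \<forall>\<^sub>F m in sequentially.
        1 / (4 * c * D) * (real m * prob (B m)) \<le> real (card {k. 1 \<le> k \<and> k \<le> m \<and> S k x \<in> B m}) \<and>
        real (card {k. 1 \<le> k \<and> k \<le> m \<and> S k x \<in> B m}) \<le> 4 * c * D * (real m * prob (B m))"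
proof -
  have events: "B m \<in> events" if "1 \<le> m" for m
    using targets that by (simp add: shrinking_targets_def)
  have fin: "finite {k. 1 \<le> k \<and> k \<le> (m::nat) \<and> Q k}" for m Q
    by (rule finite_subset[of _ "{..m}"]) auto
  have mono: "card {k. 1 \<le> k \<and> k \<le> m \<and> S k x \<in> B i} \<le> card {k. 1 \<le> k \<and> k \<le> m' \<and> S k x \<in> B i'}"
    if "m \<le> m'" "1 \<le> i'" "i' \<le> i" for m m' i i' x
    using that shrinking_targets_antimono[OF targets that(2,3)] by (intro card_mono fin) auto
  show "AE x in M. \<forall>\<^sub>F m in sequentially. \<exists>k. 1 \<le> k \<and> k \<le> m \<and> S k x \<in> B m"
    using hits
  proof eventually_elim
    case (elim x)
    from eventually_dyadic[OF this] show ?case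
    proof eventually_elim
      case (elim m)
      then obtain j where j: "2 ^ j * prob (B (2 ^ (j + 1))) / (2 * c)
          \<le> real (card {k. 1 \<le> k \<and> k \<le> 2 ^ j \<and> S k x \<in> B (2 ^ (j + 1))})"
          "2 ^ j \<le> m" "m \<le> 2 ^ (j + 1)"
        by blast
      have "0 < 2 ^ j * prob (B (2 ^ (j + 1))) / (2 * c)"
        using pos[of "2 ^ (j + 1)"] c by simp
      moreover have "1 \<le> m" using j(2) one_le_power[of "2::nat" j] by linarith
      ultimately have "0 < card {k. 1 \<le> k \<and> k \<le> m \<and> S k x \<in> B m}"
        using j mono[of "2 ^ j" m m "2 ^ (j + 1)" x] by linarith
      then have "{k. 1 \<le> k \<and> k \<le> m \<and> S k x \<in> B m} \<noteq> {}"
        by (auto simp: card_gt_0_iff)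
      then show ?case by blast
    qed
  qed
  assume D: "0 < D" and doubling: "\<forall>j\<ge>1. prob (B (2 ^ j)) \<le> D * prob (B (2 ^ (j + 1)))"
  show "AE x in M. \<forall>\<^sub>F m in sequentially.
        1 / (4 * c * D) * (real m * prob (B m)) \<le> real (card {k. 1 \<le> k \<and> k \<le> m \<and> S k x \<in> B m}) \<and>
        real (card {k. 1 \<le> k \<and> k \<le> m \<and> S k x \<in> B m}) \<le> 4 * c * D * (real m * prob (B m))"
    using hits
  proof eventually_elim
    case (elim x)
    from eventually_dyadic[OF this] show ?case
    proof eventually_elim
      case (elim m)
      then obtain j where j: "2 ^ j * prob (B (2 ^ (j + 1))) / (2 * c)
          \<le> real (card {k. 1 \<le> k \<and> k \<le> 2 ^ j \<and> S k x \<in> B (2 ^ (j + 1))})"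
          "real (card {k. 1 \<le> k \<and> k \<le> 2 ^ (j + 1) \<and> S k x \<in> B (2 ^ j)})
            \<le> 2 ^ (j + 1) * (2 * c * prob (B (2 ^ j)))"
          "j \<ge> 1" "2 ^ j \<le> m" "m \<le> 2 ^ (j + 1)"
        by blast
      have m: "1 \<le> m" using j(4) one_le_power[of "2::nat" j] by linarith
      have m_real: "2 ^ j \<le> real m" "real m \<le> 2 * 2 ^ j"
        using of_nat_mono[OF j(4), where 'a=real] of_nat_mono[OF j(5), where 'a=real] by simp_all
      let ?u = "prob (B (2 ^ j))" and ?v = "prob (B (2 ^ (j + 1)))"
      have uv: "?u \<le> D * ?v" using doubling j(3) by blast
      have B: "?v \<le> prob (B m)" "prob (B m) \<le> ?u"
        by (rule finite_measure_mono[OF shrinking_targets_antimono[OF targets m j(5)] events[OF m]],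
            rule finite_measure_mono[OF shrinking_targets_antimono[OF targets _ j(4)] events]) auto
      have "real m * prob (B m) \<le> (2 * 2 ^ j) * (D * ?v)"
        using m_real B uv by (intro mult_mono) auto
      then have "1 / (4 * c * D) * (real m * prob (B m)) \<le> 1 / (4 * c * D) * ((2 * 2 ^ j) * (D * ?v))"
        using c D by (intro mult_left_mono) auto
      also have "\<dots> = 2 ^ j * ?v / (2 * c)"
        using D by (simp add: field_simps)
      also have "\<dots> \<le> real (card {k. 1 \<le> k \<and> k \<le> m \<and> S k x \<in> B m})"
        using j(1) mono[of "2 ^ j" m m "2 ^ (j + 1)" x] j(4,5) m by linarith
      finally have 1: "1 / (4 * c * D) * (real m * prob (B m))
          \<le> real (card {k. 1 \<le> k \<and> k \<le> m \<and> S k x \<in> B m})" .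
      have "real (card {k. 1 \<le> k \<and> k \<le> m \<and> S k x \<in> B m}) \<le> 2 ^ (j + 1) * (2 * c * ?u)"
        using j(2) mono[of m "2 ^ (j + 1)" "2 ^ j" m x] j(4,5) by simp
      also have "\<dots> = 4 * c * (2 ^ j * ?u)" by simp
      also have "\<dots> \<le> 4 * c * (real m * (D * prob (B m)))"
      proof -
        have "?u \<le> D * prob (B m)"
          using uv mult_left_mono[OF B(1), of D] D by linarith
        then show ?thesis
          using m_real c by (intro mult_left_mono mult_mono) auto
      qed
      finally show ?case using 1 by (simp add: mult_ac)
    qed
  qed
qed

section \<open>The right translation action\<close>

context
  fixes \<Gamma> :: "('n::finite) lmat set"
  assumes \<Gamma>: "subgroup \<Gamma> SO0"
begin

interpretation G: group "SO0 :: 'n lmat monoid"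
  by (rule group_SO0)

lemma rcosets_SO0E:
  assumes "x \<in> rcosets\<^bsub>SO0\<^esub> \<Gamma>"
  obtains a where "a \<in> carrier SO0" "x = \<Gamma> #>\<^bsub>SO0\<^esub> a"
  using assms by (auto simp: RCOSETS_def)

lemma rcosets_SO0_subset: "x \<in> rcosets\<^bsub>SO0\<^esub> \<Gamma> \<Longrightarrow> x \<subseteq> carrier SO0"
  by (elim rcosets_SO0E) (simp add: G.r_coset_subset_G subgroup.subset[OF \<Gamma>])

lemma translate_translate:
  assumes "x \<in> rcosets\<^bsub>SO0\<^esub> \<Gamma>" "g \<in> carrier SO0" "h \<in> carrier SO0"
  shows "x #>\<^bsub>SO0\<^esub> g #>\<^bsub>SO0\<^esub> h = x #>\<^bsub>SO0\<^esub> (g ** h)"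
  using G.coset_mult_assoc[OF rcosets_SO0_subset[OF assms(1)] assms(2,3)] by simp

lemma translate_coset:
  assumes "a \<in> carrier SO0" "g \<in> carrier SO0"
  shows "\<Gamma> #>\<^bsub>SO0\<^esub> a #>\<^bsub>SO0\<^esub> g = \<Gamma> #>\<^bsub>SO0\<^esub> (a ** g)"
  using G.coset_mult_assoc[OF subgroup.subset[OF \<Gamma>] assms] by simp

lemma translate_one: "x \<in> rcosets\<^bsub>SO0\<^esub> \<Gamma> \<Longrightarrow> x #>\<^bsub>SO0\<^esub> mat 1 = x"
  using G.coset_mult_one[OF rcosets_SO0_subset] by simp

lemma translate_in_rcosets:
  assumes "x \<in> rcosets\<^bsub>SO0\<^esub> \<Gamma>" "g \<in> carrier SO0"
  shows "x #>\<^bsub>SO0\<^esub> g \<in> rcosets\<^bsub>SO0\<^esub> \<Gamma>"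
  using assms
  by (elim rcosets_SO0E)
     (auto simp: translate_coset intro!: G.rcosetsI subgroup.subset[OF \<Gamma>] SO0_mult)

lemma coset_eq:
  assumes "y \<in> rcosets\<^bsub>SO0\<^esub> \<Gamma>" "h \<in> y"
  shows "y = \<Gamma> #>\<^bsub>SO0\<^esub> h"
proof -
  obtain a where "a \<in> carrier SO0" "y = \<Gamma> #>\<^bsub>SO0\<^esub> a"
    using assms(1) by (rule rcosets_SO0E)
  then show ?thesis using G.repr_independence[of h \<Gamma> a] assms(2) \<Gamma> by simp
qed

text \<open>Open sets of cosets are encoded by their unions in the group. There, translation becomes
  right multiplication by \<open>g\<close>, and measurability on the quotient reduces to its
  continuity.\<close>

lemma Union_translate_vimage:
  assumes "U \<subseteq> rcosets\<^bsub>SO0\<^esub> \<Gamma>" "g \<in> carrier SO0"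
  shows "\<Union>{x \<in> rcosets\<^bsub>SO0\<^esub> \<Gamma>. x #>\<^bsub>SO0\<^esub> g \<in> U} = carrier SO0 \<inter> (\<lambda>h. h ** g) -` \<Union>U"
proof (intro equalityI subsetI)
  fix h assume "h \<in> \<Union>{x \<in> rcosets\<^bsub>SO0\<^esub> \<Gamma>. x #>\<^bsub>SO0\<^esub> g \<in> U}"
  then obtain x where x: "x \<in> rcosets\<^bsub>SO0\<^esub> \<Gamma>" "x #>\<^bsub>SO0\<^esub> g \<in> U" "h \<in> x" by blast
  then have "h ** g \<in> x #>\<^bsub>SO0\<^esub> g"
    by (auto simp: r_coset_def)
  then show "h \<in> carrier SO0 \<inter> (\<lambda>h. h ** g) -` \<Union>U"
    using x rcosets_SO0_subset by blast
next
  fix h assume "h \<in> carrier SO0 \<inter> (\<lambda>h. h ** g) -` \<Union>U"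
  then obtain y where h: "h \<in> carrier SO0" "y \<in> U" "h ** g \<in> y" by blast
  then have "y = \<Gamma> #>\<^bsub>SO0\<^esub> h #>\<^bsub>SO0\<^esub> g"
    using coset_eq[of y "h ** g"] assms by (auto simp: translate_coset)
  moreover have "h \<in> \<Gamma> #>\<^bsub>SO0\<^esub> h" "\<Gamma> #>\<^bsub>SO0\<^esub> h \<in> rcosets\<^bsub>SO0\<^esub> \<Gamma>"
    using h(1) G.rcos_self[OF h(1) \<Gamma>] by (auto intro!: G.rcosetsI subgroup.subset[OF \<Gamma>])
  ultimately show "h \<in> \<Union>{x \<in> rcosets\<^bsub>SO0\<^esub> \<Gamma>. x #>\<^bsub>SO0\<^esub> g \<in> U}"
    using h(2) by blast
qed

context
  fixes \<mu> :: "'n lmat set measure"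
  assumes \<mu>: "invariant_prob \<Gamma> \<mu>"
begin

lemma space_invariant_prob: "space \<mu> = rcosets\<^bsub>SO0\<^esub> \<Gamma>"
  using \<mu> by (simp add: invariant_prob_def)

lemma sets_invariant_prob: "sets \<mu> = sigma_sets (rcosets\<^bsub>SO0\<^esub> \<Gamma>) (coset_opens \<Gamma>)"
proof -
  have "coset_opens \<Gamma> \<subseteq> Pow (rcosets\<^bsub>SO0\<^esub> \<Gamma>)"
    by (auto simp: coset_opens_def)
  then show ?thesis
    using \<mu> by (simp add: invariant_prob_def coset_borel_def)
qed

lemma measurable_translate:
  assumes g: "g \<in> carrier SO0"
  shows "(\<lambda>x. x #>\<^bsub>SO0\<^esub> g) \<in> measurable \<mu> \<mu>"
proof (rule measurable_sigma_sets[OF sets_invariant_prob])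
  show "coset_opens \<Gamma> \<subseteq> Pow (rcosets\<^bsub>SO0\<^esub> \<Gamma>)"
    by (auto simp: coset_opens_def)
  show "(\<lambda>x. x #>\<^bsub>SO0\<^esub> g) \<in> space \<mu> \<rightarrow> rcosets\<^bsub>SO0\<^esub> \<Gamma>"
    using translate_in_rcosets g by (auto simp: space_invariant_prob)
  fix U assume U: "U \<in> coset_opens \<Gamma>"
  have "(\<lambda>x. x #>\<^bsub>SO0\<^esub> g) -` U \<inter> space \<mu> = {x \<in> rcosets\<^bsub>SO0\<^esub> \<Gamma>. x #>\<^bsub>SO0\<^esub> g \<in> U}"
    by (auto simp: space_invariant_prob)
  also have "\<dots> \<in> coset_opens \<Gamma>"
  proof -
    have "openin (top_of_set (carrier SO0)) (carrier SO0 \<inter> (\<lambda>h. h ** g) -` \<Union>U)"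
      using U g by (intro continuous_openin_preimage[where T = "carrier SO0"])
        (auto intro!: continuous_intros simp: SO0_mult coset_opens_def)
    then show ?thesis
      using U Union_translate_vimage[OF _ g, of U] by (auto simp: coset_opens_def)
  qed
  finally show "(\<lambda>x. x #>\<^bsub>SO0\<^esub> g) -` U \<inter> space \<mu> \<in> sets \<mu>"
    by (auto simp: sets_invariant_prob)
qed

text \<open>Invariance is stated for images of sets while a pushforward is computed from preimages;
  the inverse of \<open>g\<close> exchanges the two.\<close>

lemma distr_translate:
  assumes g: "g \<in> carrier SO0"
  shows "distr \<mu> \<mu> (\<lambda>x. x #>\<^bsub>SO0\<^esub> g) = \<mu>"
proof (rule measure_eqI)
  fix E assume "E \<in> sets (distr \<mu> \<mu> (\<lambda>x. x #>\<^bsub>SO0\<^esub> g))"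
  then have E: "E \<in> sets \<mu>" by simp
  then have sub: "E \<subseteq> rcosets\<^bsub>SO0\<^esub> \<Gamma>"
    using sets.sets_into_space space_invariant_prob by blast
  have inv: "matrix_inv g \<in> carrier SO0" "g ** matrix_inv g = mat 1" "matrix_inv g ** g = mat 1"
    using g by (auto simp: SO0_inv matrix_inv_invertible SO0_invertible)
  have "(\<lambda>x. x #>\<^bsub>SO0\<^esub> g) -` E \<inter> space \<mu> = (\<lambda>x. x #>\<^bsub>SO0\<^esub> matrix_inv g) ` E"
  proof (intro equalityI subsetI)
    fix x assume "x \<in> (\<lambda>x. x #>\<^bsub>SO0\<^esub> g) -` E \<inter> space \<mu>"
    then show "x \<in> (\<lambda>x. x #>\<^bsub>SO0\<^esub> matrix_inv g) ` E"
      using g inv by (intro image_eqI[of _ _ "x #>\<^bsub>SO0\<^esub> g"])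
        (auto simp: space_invariant_prob translate_translate translate_one)
  next
    fix x assume "x \<in> (\<lambda>x. x #>\<^bsub>SO0\<^esub> matrix_inv g) ` E"
    then show "x \<in> (\<lambda>x. x #>\<^bsub>SO0\<^esub> g) -` E \<inter> space \<mu>"
      using g inv sub by (auto simp: space_invariant_prob translate_translate translate_one translate_in_rcosets subset_iff)
  qed
  then show "emeasure (distr \<mu> \<mu> (\<lambda>x. x #>\<^bsub>SO0\<^esub> g)) E = emeasure \<mu> E"
    using \<mu> E inv(1) by (simp add: emeasure_distr measurable_translate g invariant_prob_def)
qed simp

lemma integral_translate:
  fixes f :: "'n lmat set \<Rightarrow> real"
  assumes "g \<in> carrier SO0" "f \<in> borel_measurable \<mu>"
  shows "(\<integral>x. f (x #>\<^bsub>SO0\<^esub> g) \<partial>\<mu>) = (\<integral>x. f x \<partial>\<mu>)"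
  using integral_distr[OF measurable_translate[OF assms(1)] assms(2)] distr_translate[OF assms(1)]
  by simp

end

end

section \<open>Growth of the one-parameter group\<close>

lemma diagonalizable_group_time_entry:
  fixes g :: "int \<Rightarrow> ('n::{finite,linorder}) lmat"
  assumes g: "one_parameter_group g" and \<tau>: "\<tau> \<in> carrier SO0" and k: "k \<in> max_compact"
    and comm: "\<And>t. k ** a_mat t = a_mat t ** k"
    and g1: "g 1 = matrix_inv \<tau> ** k ** a_mat c ** \<tau>"
  shows "(\<tau> ** g (int m) ** matrix_inv \<tau>) $ None $ None = cosh (real m * c)"
proof -
  have inv: "\<tau> ** matrix_inv \<tau> = mat 1" "matrix_inv \<tau> ** \<tau> = mat 1"
    using \<tau> by (auto simp: matrix_inv_invertible SO0_invertible)
  obtain P where P: "k = block_K P" using k by (auto simp: max_compact_def)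
  \<comment> \<open>The group law forces the value at 0, since \<open>g 0\<close> is an idempotent
    of a group.\<close>
  have g0: "g 0 = mat 1"
  proof -
    have inv0: "matrix_inv (g 0) ** g 0 = mat 1"
      using g by (simp add: one_parameter_group_def matrix_inv_invertible SO0_invertible)
    have "g 0 ** g 0 = g 0" using g by (simp add: one_parameter_group_def)
    then have "matrix_inv (g 0) ** g 0 ** g 0 = matrix_inv (g 0) ** g 0"
      by (simp flip: matrix_mul_assoc)
    then show ?thesis by (simp add: inv0)
  qed
  \<comment> \<open>The K-factors commute past the boosts and accumulate in some block. Its
    existence is enough: the time row of a block matrix is the time axis, so the time entry is that
    of the boost.\<close>
  have "\<exists>Q. \<tau> ** g (int m) ** matrix_inv \<tau> = block_K Q ** a_mat (real m * c)"
  proof (induction m)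
    case 0
    show ?case
      by (rule exI[of _ "mat 1"]) (simp add: g0 inv block_K_one a_mat_0)
  next
    case (Suc m)
    then obtain Q where Q: "\<tau> ** g (int m) ** matrix_inv \<tau> = block_K Q ** a_mat (real m * c)" by blast
    have "g (int (Suc m)) = g (int m) ** g 1"
      using g by (simp add: one_parameter_group_def add.commute)
    then have "\<tau> ** g (int (Suc m)) ** matrix_inv \<tau>
        = \<tau> ** g (int m) ** (matrix_inv \<tau> ** k ** a_mat c ** (\<tau> ** matrix_inv \<tau>))"
      by (simp add: g1 matrix_mul_assoc)
    also have "\<dots> = (\<tau> ** g (int m) ** matrix_inv \<tau>) ** k ** a_mat c"
      by (simp add: inv matrix_mul_assoc)
    also have "\<dots> = block_K Q ** (a_mat (real m * c) ** k) ** a_mat c"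
      by (simp add: Q matrix_mul_assoc)
    also have "\<dots> = (block_K Q ** k) ** (a_mat (real m * c) ** a_mat c)"
      by (simp add: comm[symmetric] matrix_mul_assoc)
    also have "\<dots> = block_K (Q ** P) ** a_mat (real (Suc m) * c)"
      by (simp add: P block_K_mult a_mat_add algebra_simps)
    finally show ?case by blast
  qed
  then obtain Q where Q: "\<tau> ** g (int m) ** matrix_inv \<tau> = block_K Q ** a_mat (real m * c)" by blast
  show ?thesis
    unfolding Q by (simp add: matrix_mult_nth sum_option a_mat_nth)
qed

text \<open>Conjugation by \<tau> and the outer K-factors distort entries by bounded factors only,
  so cosh (m * c) is at most a constant times cosh t for every Cartan decomposition of
  \<open>g (int m)\<close>. Hence the rate is |c|.\<close>

lemma diagonalizable_group_cartan:
  fixes g :: "int \<Rightarrow> ('n::{finite,linorder}) lmat"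
  assumes n: "CARD('n) \<ge> 2" and g: "one_parameter_group g" "diagonalizable_group g"
  obtains \<epsilon> C where "\<epsilon> > 0" "C > 0"
    "\<And>m. \<exists>k1\<in>max_compact. \<exists>k2\<in>max_compact. \<exists>t\<ge>0.
      g (int m) = k1 ** a_mat t ** k2 \<and> exp (- t) \<le> C * exp (- \<epsilon> * real m)"
proof -
  obtain \<tau> k c where \<tau>: "\<tau> \<in> carrier SO0" and k: "k \<in> max_compact" and c: "c \<noteq> 0"
    and comm: "\<And>t. k ** a_mat t = a_mat t ** k" and g1: "g 1 = matrix_inv \<tau> ** k ** a_mat c ** \<tau>"
    using g(2) unfolding diagonalizable_group_def by blast
  have ex_bound: "\<exists>b. \<forall>i j. \<bar>A $ i $ j\<bar> \<le> b" for A :: "'n lmat"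
    by (intro exI[of _ "norm A"] allI) (rule matrix_entry_le_norm)
  obtain b1 where b1: "\<And>i j. \<bar>\<tau> $ i $ j\<bar> \<le> b1" using ex_bound by blast
  obtain b2 where b2: "\<And>i j. \<bar>matrix_inv \<tau> $ i $ j\<bar> \<le> b2" using ex_bound by blast
  define D where "D = real CARD('n option)"
  \<comment> \<open>The shape follows the nesting of \<open>matrix_mult_entry_bound\<close> over the
    five matrices \<tau>, k1, a_t, k2 and the inverse of \<tau>. Two of the factors 1 bound the
    entries of k1 and k2, the third holds the place of cosh t.\<close>
  define C where "C = D * (D * (b1 * (D * (D * (1 * 1) * 1))) * b2)"
  have bound: "exp (\<bar>c\<bar> * real m) \<le> 2 * C * exp t"
    if kk: "k1 \<in> max_compact" "k2 \<in> max_compact" "t \<ge> 0" "g (int m) = k1 ** a_mat t ** k2" for k1 k2 t m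
  proof -
    have entry: "\<bar>g (int m) $ i $ j\<bar> \<le> D * (D * (1 * cosh t) * 1)" for i j
      unfolding D_def kk(4) by (intro matrix_mult_entry_bound max_compact_entry a_mat_entry kk)
    have "\<bar>(\<tau> ** g (int m) ** matrix_inv \<tau>) $ None $ None\<bar>
        \<le> D * (D * (b1 * (D * (D * (1 * cosh t) * 1))) * b2)"
      using entry unfolding D_def by (intro matrix_mult_entry_bound b1 b2)
    then have cosh_le: "cosh (real m * c) \<le> C * cosh t"
      unfolding diagonalizable_group_time_entry[OF g(1) \<tau> k comm g1]
      by (simp add: C_def mult_ac)
    have "0 < C * cosh t"
      using cosh_real_pos[of "real m * c"] cosh_le by linarith
    then have "C > 0"
      using cosh_real_pos[of t] by (simp add: zero_less_mult_iff)
    have "exp (\<bar>c\<bar> * real m) \<le> 2 * cosh (real m * c)"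
      using exp_abs_le_cosh[of "real m * c"] by (simp add: abs_mult mult.commute)
    also have "\<dots> \<le> 2 * (C * exp t)"
      using cosh_le mult_left_mono[OF cosh_le_exp[OF kk(3)], of C] \<open>C > 0\<close> by linarith
    finally show ?thesis by simp
  qed
  show thesis
  \<comment> \<open>Positivity of \<open>C\<close> emerges only from a given decomposition; the
    maximum with 1 makes the constant positive beforehand.\<close>
  proof (rule that[of "\<bar>c\<bar>" "max 1 (2 * C)"])
    fix m
    have "g (int m) \<in> carrier SO0" using g(1) by (simp add: one_parameter_group_def)
    then obtain k1 k2 t where kk: "k1 \<in> max_compact" "k2 \<in> max_compact" "t \<ge> 0"
        "g (int m) = k1 ** a_mat t ** k2"
      using SO0_cartan_decomposition[OF n] by metis
    have "exp (\<bar>c\<bar> * real m) \<le> max 1 (2 * C) * exp t"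
      by (rule order_trans[OF bound[OF kk] mult_right_mono]) auto
    then have "exp (- t) \<le> max 1 (2 * C) * exp (- \<bar>c\<bar> * real m)"
      by (simp add: exp_minus field_simps)
    then show "\<exists>k1\<in>max_compact. \<exists>k2\<in>max_compact. \<exists>t\<ge>0.
        g (int m) = k1 ** a_mat t ** k2 \<and> exp (- t) \<le> max 1 (2 * C) * exp (- \<bar>c\<bar> * real m)"
      using kk by blast
  qed (use c in auto)
qed

section \<open>Lie derivatives and Sobolev norms\<close>

lemma Ck_on_cong:
  assumes "open U" "\<And>x. x \<in> U \<Longrightarrow> f x = g x"
  shows "Ck_on k U f \<longleftrightarrow> Ck_on k U g"
  using assms(2)
proof (induction k arbitrary: f g)
  case 0
  then show ?case by (auto intro: continuous_on_cong)
next
  case (Suc k)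
  \<comment> \<open>Both functions have the same derivatives at each point of the open set, so the
    choice operator in \<open>frechet_derivative\<close> picks the same value for both.\<close>
  have der: "(f has_derivative D) (at x) \<longleftrightarrow> (g has_derivative D) (at x)" if "x \<in> U" for x D
    by (rule iffI; erule has_derivative_transform_within_open[OF _ assms(1) that]) (simp_all add: Suc.prems)
  have diff: "f differentiable (at x) \<longleftrightarrow> g differentiable (at x)" if "x \<in> U" for x
    unfolding differentiable_def der[OF that] ..
  have "frechet_derivative f (at x) = frechet_derivative g (at x)" if "x \<in> U" for x
    unfolding frechet_derivative_def der[OF that] ..
  then have "Ck_on k U (\<lambda>x. frechet_derivative f (at x) v)
      \<longleftrightarrow> Ck_on k U (\<lambda>x. frechet_derivative g (at x) v)" for v
    by (intro Suc.IH) simp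
  with diff show ?case by simp
qed

lemma Ck_on_transform:
  "open U \<Longrightarrow> Ck_on k U g \<Longrightarrow> (\<And>x. x \<in> U \<Longrightarrow> f x = g x) \<Longrightarrow> Ck_on k U f"
  using Ck_on_cong by blast

lemma Ck_on_Suc_imp: "Ck_on (Suc k) U f \<Longrightarrow> Ck_on k U f"
proof (induction k arbitrary: f)
  case 0
  then show ?case
    by (auto intro!: continuous_at_imp_continuous_on differentiable_imp_continuous_within)
next
  case (Suc k)
  then show ?case by (metis Ck_on.simps(2))
qed

lemma Ck_on_const: "Ck_on k U (\<lambda>x. c)"
  by (induction k arbitrary: c) simp_all

lemma Ck_on_bounded_linear: "bounded_linear L \<Longrightarrow> Ck_on k U L"
proof (cases k)
  case (Suc i)
  assume L: "bounded_linear L"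
  then have "frechet_derivative L (at x) = L" for x
    by (metis bounded_linear_imp_has_derivative frechet_derivative_at)
  then show ?thesis
    using L by (auto simp: Suc Ck_on_const intro: bounded_linear_imp_differentiable)
qed (simp add: linear_continuous_on)

lemma Ck_on_add:
  assumes "open U" "Ck_on k U f" "Ck_on k U g"
  shows "Ck_on k U (\<lambda>x. f x + g x)"
  using assms(2,3)
proof (induction k arbitrary: f g)
  case (Suc k)
  have d: "frechet_derivative (\<lambda>x. f x + g x) (at x) v
      = frechet_derivative f (at x) v + frechet_derivative g (at x) v" if "x \<in> U" for x v
    using Suc.prems that
    by (subst frechet_derivative_at[OF has_derivative_add, symmetric])
       (auto simp: frechet_derivative_works)
  have k: "Ck_on k U (\<lambda>x. frechet_derivative f (at x) v + frechet_derivative g (at x) v)" for v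
    using Suc by simp
  have "Ck_on k U (\<lambda>x. frechet_derivative (\<lambda>x. f x + g x) (at x) v)" for v
    by (rule Ck_on_transform[OF assms(1) k d])
  then show ?case using Suc.prems by (auto intro: differentiable_add)
qed (auto intro: continuous_intros)

lemma Ck_on_sum:
  assumes "open U" "finite I" "\<And>i. i \<in> I \<Longrightarrow> Ck_on k U (f i)"
  shows "Ck_on k U (\<lambda>x. \<Sum>i\<in>I. f i x)"
  using assms(2,3)
  by (induction I rule: finite_induct) (auto simp: Ck_on_const Ck_on_add assms(1))

lemma Ck_on_scaleR:
  fixes a :: "'a::euclidean_space \<Rightarrow> real"
  assumes "open U" "Ck_on k U a" "Ck_on k U f"
  shows "Ck_on k U (\<lambda>x. a x *\<^sub>R f x)"
  using assms(2,3)
proof (induction k arbitrary: a f)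
  case (Suc k)
  have d: "frechet_derivative (\<lambda>x. a x *\<^sub>R f x) (at x) v
      = a x *\<^sub>R frechet_derivative f (at x) v + frechet_derivative a (at x) v *\<^sub>R f x" if "x \<in> U" for x v
    using Suc.prems that
    by (subst frechet_derivative_at[OF has_derivative_scaleR, symmetric])
       (auto simp: frechet_derivative_works)
  have k: "Ck_on k U (\<lambda>x. a x *\<^sub>R frechet_derivative f (at x) v + frechet_derivative a (at x) v *\<^sub>R f x)" for v
    using Suc Ck_on_Suc_imp[OF Suc.prems(1)] Ck_on_Suc_imp[OF Suc.prems(2)]
    by (intro Ck_on_add assms(1)) auto
  have "Ck_on k U (\<lambda>x. frechet_derivative (\<lambda>x. a x *\<^sub>R f x) (at x) v)" for v
    by (rule Ck_on_transform[OF assms(1) k d])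
  then show ?case using Suc.prems by (auto intro: differentiable_scaleR)
qed (auto intro: continuous_intros)

lemma Ck_on_affine:
  assumes "open U" "bounded_linear L" "Ck_on k U f"
  shows "Ck_on k U (\<lambda>x. L (f x) + c)"
  using assms(3)
proof (induction k arbitrary: f c)
  case 0
  then show ?case
    by (auto intro!: continuous_intros bounded_linear.continuous_on[OF assms(2)])
next
  case (Suc k)
  have der: "((\<lambda>x. L (f x) + c) has_derivative (\<lambda>v. L (frechet_derivative f (at x) v))) (at x)"
    if "x \<in> U" for x
    using Suc.prems that
    by (auto intro!: derivative_eq_intros bounded_linear.has_derivative[OF assms(2)]
        simp: frechet_derivative_works)
  \<comment> \<open>The added 0 keeps the derivative in affine form, so that the induction
    hypothesis, general in \<open>c\<close>, applies to it.\<close>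
  then have d: "frechet_derivative (\<lambda>x. L (f x) + c) (at x) v = L (frechet_derivative f (at x) v) + 0"
    if "x \<in> U" for x v
    using that by (simp add: fun_cong[OF frechet_derivative_at[OF der[OF that]], symmetric])
  have k: "Ck_on k U (\<lambda>x. L (frechet_derivative f (at x) v) + 0)" for v
    using Suc by (intro Suc.IH) simp
  have "Ck_on k U (\<lambda>x. frechet_derivative (\<lambda>x. L (f x) + c) (at x) v)" for v
    by (rule Ck_on_transform[OF assms(1) k d])
  then show ?case using der by (auto simp: differentiable_def)
qed

text \<open>\<open>Ck_on\<close> controls derivatives in constant directions, whereas a Lie
  derivative uses the direction \<open>h ** X\<close>, which moves with the point. Expanding this
  direction in a basis leaves products with linear coordinate functions.\<close>

lemma smooth_directional_derivative:
  fixes F :: "'a::euclidean_space \<Rightarrow> 'b::real_normed_vector"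
  assumes U: "open U" and F: "\<And>k. Ck_on k U F" and L: "bounded_linear L"
  shows "Ck_on k U (\<lambda>x. frechet_derivative F (at x) (L x))"
proof (rule Ck_on_transform[OF U])
  have Db: "Ck_on k U (\<lambda>x. frechet_derivative F (at x) b)" for b
    using F[of "Suc k"] by simp
  have Lb: "Ck_on k U (\<lambda>x. L x \<bullet> b)" for b
    by (rule Ck_on_bounded_linear[OF bounded_linear_inner_left_comp[OF L]])
  show "Ck_on k U (\<lambda>x. \<Sum>b\<in>Basis. (L x \<bullet> b) *\<^sub>R frechet_derivative F (at x) b)"
    by (rule Ck_on_sum[OF U finite_Basis Ck_on_scaleR[OF U Lb Db]])
  fix x assume "x \<in> U"
  then have "linear (frechet_derivative F (at x))"
    using F[of "Suc 0"] linear_frechet_derivative by auto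
  then have "frechet_derivative F (at x) (\<Sum>b\<in>Basis. (L x \<bullet> b) *\<^sub>R b)
      = (\<Sum>b\<in>Basis. (L x \<bullet> b) *\<^sub>R frechet_derivative F (at x) b)"
    by (simp add: linear_sum linear_cmul)
  then show "frechet_derivative F (at x) (L x)
      = (\<Sum>b\<in>Basis. (L x \<bullet> b) *\<^sub>R frechet_derivative F (at x) b)"
    by (simp only: euclidean_representation)
qed

section \<open>The matrix exponential, entry by entry\<close>

lemma matrix_power_scaleR:
  fixes X :: "real^'m^'m"
  shows "((**) (t *\<^sub>R X) ^^ k) (mat 1) = t ^ k *\<^sub>R ((**) X ^^ k) (mat 1)"
proof (induction k)
  case (Suc k)
  then show ?case
    by (simp add: vec_eq_iff matrix_mult_nth sum_distrib_left mult_ac)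
qed simp

lemma matrix_power_entry_bound:
  fixes X :: "real^'m^'m"
  shows "\<exists>r. \<forall>k i j. \<bar>((**) X ^^ k) (mat 1) $ i $ j\<bar> \<le> r ^ k"
proof -
  have "\<bar>((**) X ^^ k) (mat 1) $ i $ j\<bar> \<le> (real CARD('m) * norm X) ^ k" for k i j
  proof (induction k arbitrary: i j)
    case (Suc k)
    have "\<bar>(X ** ((**) X ^^ k) (mat 1)) $ i $ j\<bar>
        \<le> real CARD('m) * (norm X * (real CARD('m) * norm X) ^ k)"
      by (intro matrix_mult_entry_bound matrix_entry_le_norm Suc.IH)
    then show ?case by (simp add: mult_ac)
  qed (simp add: mat_def)
  then show ?thesis by blast
qed

text \<open>Each entry is a real power series in \<open>t\<close> dominated by an exponential
  series, which opens the way to termwise differentiation.\<close>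

lemma mat_exp_nth:
  fixes X :: "real^'m^'m"
  shows "(\<lambda>k. ((**) X ^^ k) (mat 1) $ i $ j / fact k * t ^ k) sums (mat_exp (t *\<^sub>R X) $ i $ j)"
proof -
  obtain r where r: "\<And>k i j. \<bar>((**) X ^^ k) (mat 1) $ i $ j\<bar> \<le> r ^ k"
    using matrix_power_entry_bound by blast
  let ?a = "\<lambda>i j k. ((**) X ^^ k) (mat 1) $ i $ j / fact k * t ^ k"
  have "summable (?a i j)" for i j
  proof (rule summable_comparison_test)
    have "norm (?a i j k) \<le> (r * \<bar>t\<bar>) ^ k /\<^sub>R fact k" for k
      using mult_right_mono[OF r[of k i j], of "\<bar>t\<bar> ^ k"]
      by (simp add: abs_mult power_abs power_mult_distrib divide_simps)
    then show "\<exists>N. \<forall>k\<ge>N. norm (?a i j k) \<le> (r * \<bar>t\<bar>) ^ k /\<^sub>R fact k" by blast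
    show "summable (\<lambda>k. (r * \<bar>t\<bar>) ^ k /\<^sub>R fact k)"
      by (rule summable_exp_generic)
  qed
  then have "(\<lambda>k. (1 / fact k) *\<^sub>R (((**) (t *\<^sub>R X) ^^ k) (mat 1))) sums (\<chi> i j. suminf (?a i j))"
    unfolding sums_def matrix_power_scaleR
    by (intro vec_tendstoI) (simp add: summable_LIMSEQ mult_ac)
  then have "mat_exp (t *\<^sub>R X) = (\<chi> i j. suminf (?a i j))"
    unfolding mat_exp_def by (rule sums_unique[symmetric])
  then show ?thesis
    using \<open>\<And>i j. summable (?a i j)\<close> by (simp add: summable_sums)
qed

lemma mat_exp_has_vector_derivative:
  fixes X :: "real^'m^'m"
  shows "((\<lambda>t. mat_exp (t *\<^sub>R X)) has_vector_derivative X) (at 0)"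
proof -
  have entry: "((\<lambda>t. mat_exp (t *\<^sub>R X) $ i $ j) has_real_derivative X $ i $ j) (at 0)" for i j
  proof -
    let ?c = "\<lambda>k. ((**) X ^^ k) (mat 1) $ i $ j / fact k"
    have "DERIV (\<lambda>t. \<Sum>k. ?c k * t ^ k) 0 :> (\<Sum>k. diffs ?c k * 0 ^ k)"
      using mat_exp_nth[of X i j] by (intro termdiffs_strong_converges_everywhere) (simp add: sums_iff)
    moreover have "(\<Sum>k. diffs ?c k * 0 ^ k) = X $ i $ j"
      by (subst powser_zero) (simp add: diffs_def)
    ultimately show ?thesis
      using mat_exp_nth[of X i j] by (simp add: sums_iff)
  qed
  have "((\<lambda>t. mat_exp (t *\<^sub>R X) \<bullet> b) has_derivative (\<lambda>t. (t *\<^sub>R X) \<bullet> b)) (at 0)"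
    if Basis: "b \<in> Basis" for b
  proof -
    obtain i j where b: "b = axis i (axis j 1)"
      using Basis by (auto simp: Basis_vec_def)
    have "(\<lambda>t. (t *\<^sub>R X) \<bullet> b) = (*) (X $ i $ j)"
      by (auto simp: b inner_axis fun_eq_iff)
    then show ?thesis
      using entry[of i j]
      by (simp add: b inner_axis has_field_derivative_def)
  qed
  then show ?thesis
    unfolding has_vector_derivative_def by (subst has_derivative_componentwise_within) blast
qed

lemma mat_exp_0: "mat_exp (0 *\<^sub>R X) = mat 1"
proof -
  have "mat_exp (0 *\<^sub>R X) $ i $ j = mat 1 $ i $ j" for i j
    using mat_exp_nth[of X i j 0] sums_unique2[OF _ powser_sums_zero, of "\<lambda>k. ((**) X ^^ k) (mat 1) $ i $ j / fact k"]
    by simp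
  then show ?thesis by (simp add: vec_eq_iff)
qed

lemma bounded_linear_matrix_mult_left: "bounded_linear (\<lambda>A. h ** A)"
  for h :: "real^'m^'m"
  by (intro linear_conv_bounded_linear[THEN iffD1] linearI)
     (simp_all add: vec_eq_iff matrix_mult_nth sum.distrib sum_distrib_left algebra_simps)

lemma bounded_linear_matrix_mult_right: "bounded_linear (\<lambda>A. A ** h)"
  for h :: "real^'m^'m"
  by (intro linear_conv_bounded_linear[THEN iffD1] linearI)
     (simp_all add: vec_eq_iff matrix_mult_nth sum.distrib sum_distrib_left algebra_simps)

section \<open>Smooth functions on the coset space\<close>

lemma smooth_coset_funE:
  assumes "smooth_coset_fun \<Gamma> f" "g \<in> carrier SO0"
  obtains U F where "open U" "g \<in> U" "\<forall>k. Ck_on k U F"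
    "\<forall>y\<in>U \<inter> carrier SO0. F y = f (\<Gamma> #>\<^bsub>SO0\<^esub> y)"
proof -
  from bspec[OF assms(1)[unfolded smooth_coset_fun_def smooth_on_submanifold_def] assms(2)]
  show thesis using that by (elim exE conjE)
qed

text \<open>Passage from the real test functions to the complex mean-zero functions of
  \<open>matrix_coeff_decay\<close>; \<open>m\<close> will be the mean.\<close>

lemma smooth_coset_fun_affine:
  fixes f :: "('n::finite) lmat set \<Rightarrow> real"
  assumes "smooth_coset_fun \<Gamma> f"
  shows "smooth_coset_fun \<Gamma> (\<lambda>x. complex_of_real (f x - m))"
  unfolding smooth_coset_fun_def smooth_on_submanifold_def
proof
  fix g :: "'n lmat" assume "g \<in> carrier SO0"
  with assms obtain U F where "open U" "g \<in> U" "\<forall>k. Ck_on k U F"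
    "\<forall>y\<in>U \<inter> carrier SO0. F y = f (\<Gamma> #>\<^bsub>SO0\<^esub> y)"
    by (rule smooth_coset_funE)
  then have U: "open U" "g \<in> U" and F: "\<And>k. Ck_on k U F"
    and eq: "\<And>y. y \<in> U \<inter> carrier SO0 \<Longrightarrow> F y = f (\<Gamma> #>\<^bsub>SO0\<^esub> y)"
    by simp_all
  have "Ck_on k U (\<lambda>x. complex_of_real (F x) + complex_of_real (- m))" for k
    by (rule Ck_on_affine[OF U(1) bounded_linear_of_real F])
  then show "\<exists>U F. open U \<and> g \<in> U \<and> (\<forall>k. Ck_on k U F) \<and>
      (\<forall>y\<in>U \<inter> carrier SO0. F y = complex_of_real (f (\<Gamma> #>\<^bsub>SO0\<^esub> y) - m))"
    by (intro exI[of _ U] exI[of _ "\<lambda>x. complex_of_real (F x) + complex_of_real (- m)"] conjI allI ballI U)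
       (simp_all add: eq)
qed

lemma exp_mem_SO0: "X \<in> lie_algebra \<Longrightarrow> mat_exp (t *\<^sub>R X) \<in> carrier SO0"
  by (simp add: lie_algebra_def)

text \<open>\<open>lie_deriv\<close> is informative only where the derivative exists. Existence
  comes from the chain rule for a local extension F along the curve h exp (t X), which stays in the
  group and, for small t, in U.\<close>

lemma has_vector_derivative_along_exp:
  fixes f :: "('n::finite) lmat set \<Rightarrow> 'b::real_normed_vector"
  assumes \<Gamma>: "subgroup \<Gamma> SO0" and X: "X \<in> lie_algebra"
    and U: "open U" "h \<in> U" "h \<in> carrier SO0" and F: "F differentiable (at h)"
    and eq: "\<And>y. y \<in> U \<inter> carrier SO0 \<Longrightarrow> F y = f (\<Gamma> #>\<^bsub>SO0\<^esub> y)"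
  shows "((\<lambda>t. f (\<Gamma> #>\<^bsub>SO0\<^esub> h #>\<^bsub>SO0\<^esub> mat_exp (t *\<^sub>R X))) has_vector_derivative
     frechet_derivative F (at h) (h ** X)) (at 0)"
proof -
  let ?\<gamma> = "\<lambda>t. h ** mat_exp (t *\<^sub>R X)"
  have \<gamma>: "(?\<gamma> has_vector_derivative (h ** X)) (at 0)"
    by (rule bounded_linear.has_vector_derivative[OF bounded_linear_matrix_mult_left mat_exp_has_vector_derivative])
  have \<gamma>0: "?\<gamma> 0 = h"
    using mat_exp_0[of X] by simp
  have "(F has_derivative frechet_derivative F (at h)) (at (?\<gamma> 0))"
    using F unfolding \<gamma>0 by (simp add: frechet_derivative_works)
  then have comp: "((\<lambda>t. F (?\<gamma> t)) has_vector_derivative frechet_derivative F (at h) (h ** X)) (at 0)"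
    using vector_derivative_diff_chain_within[OF \<gamma>, of F "frechet_derivative F (at h)"]
    by (simp add: o_def has_derivative_at_withinI)
  have "isCont ?\<gamma> 0"
    using \<gamma> by (rule has_vector_derivative_continuous)
  then have "\<forall>\<^sub>F t in at 0. ?\<gamma> t \<in> U"
    using U(1,2) \<gamma>0 by (auto simp: isCont_def intro: topological_tendstoD)
  then have ev: "\<forall>\<^sub>F t in at 0. F (?\<gamma> t) = f (\<Gamma> #>\<^bsub>SO0\<^esub> h #>\<^bsub>SO0\<^esub> mat_exp (t *\<^sub>R X))"
    by eventually_elim
       (simp add: eq translate_coset[OF \<Gamma>] U(3) exp_mem_SO0[OF X] SO0_mult)
  have "F (?\<gamma> 0) = f (\<Gamma> #>\<^bsub>SO0\<^esub> h #>\<^bsub>SO0\<^esub> mat_exp (0 *\<^sub>R X))"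
    using U eq[of h] by (simp add: \<gamma>0[simplified] translate_coset[OF \<Gamma>] exp_mem_SO0[OF X, of 0, simplified])
  with comp ev show ?thesis
    unfolding has_vector_derivative_def by (rule has_derivative_transform_eventually) simp
qed

context
  fixes \<Gamma> and X :: "('n::finite) lmat" and f :: "'n lmat set \<Rightarrow> 'b::real_normed_vector"
  assumes \<Gamma>: "subgroup \<Gamma> SO0" and f: "smooth_coset_fun \<Gamma> f" and X: "X \<in> lie_algebra"
begin

lemma lie_deriv_has_vector_derivative:
  assumes "x \<in> rcosets\<^bsub>SO0\<^esub> \<Gamma>"
  shows "((\<lambda>t. f (x #>\<^bsub>SO0\<^esub> mat_exp (t *\<^sub>R X))) has_vector_derivative lie_deriv X f x) (at 0)"
proof -
  obtain h where h: "h \<in> carrier SO0" "x = \<Gamma> #>\<^bsub>SO0\<^esub> h"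
    using rcosets_SO0E[OF \<Gamma> assms] .
  from f h(1) obtain U F where "open U" "h \<in> U" "\<forall>k. Ck_on k U F"
    "\<forall>y\<in>U \<inter> carrier SO0. F y = f (\<Gamma> #>\<^bsub>SO0\<^esub> y)"
    by (rule smooth_coset_funE)
  then have U: "open U" "h \<in> U" and F: "\<And>k. Ck_on k U F"
    and eq: "\<And>y. y \<in> U \<inter> carrier SO0 \<Longrightarrow> F y = f (\<Gamma> #>\<^bsub>SO0\<^esub> y)"
    by simp_all
  have "F differentiable (at h)"
    using F[of "Suc 0"] U(2) by simp
  from has_vector_derivative_along_exp[OF \<Gamma> X U h(1) this eq]
  show ?thesis
    unfolding h(2)[symmetric] by (metis lie_deriv_def vector_derivative_at)
qed

text \<open>The map sending h to the derivative of F at h in direction \<open>h ** X\<close> is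
  again a smooth local extension, so Lie derivatives can be iterated along words.\<close>

lemma smooth_lie_deriv: "smooth_coset_fun \<Gamma> (lie_deriv X f)"
  unfolding smooth_coset_fun_def smooth_on_submanifold_def
proof
  fix g :: "'n lmat" assume "g \<in> carrier SO0"
  with f obtain U F where "open U" "g \<in> U" "\<forall>k. Ck_on k U F"
    "\<forall>y\<in>U \<inter> carrier SO0. F y = f (\<Gamma> #>\<^bsub>SO0\<^esub> y)"
    by (rule smooth_coset_funE)
  then have U: "open U" "g \<in> U" and F: "\<And>k. Ck_on k U F"
    and eq: "\<And>y. y \<in> U \<inter> carrier SO0 \<Longrightarrow> F y = f (\<Gamma> #>\<^bsub>SO0\<^esub> y)"
    by simp_all
  let ?DF = "\<lambda>h. frechet_derivative F (at h) (h ** X)"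
  have "?DF h = lie_deriv X f (\<Gamma> #>\<^bsub>SO0\<^esub> h)" if "h \<in> U \<inter> carrier SO0" for h
  proof -
    have "F differentiable (at h)"
      using F[of "Suc 0"] that by simp
    then show ?thesis
      using has_vector_derivative_along_exp[where F = F and f = f and h = h, OF \<Gamma> X U(1) _ _ _ eq] that
      by (simp add: lie_deriv_def vector_derivative_at)
  qed
  moreover have "Ck_on k U ?DF" for k
    by (rule smooth_directional_derivative[OF U(1) F bounded_linear_matrix_mult_right])
  ultimately show "\<exists>U F. open U \<and> g \<in> U \<and> (\<forall>k. Ck_on k U F) \<and>
      (\<forall>y\<in>U \<inter> carrier SO0. F y = lie_deriv X f (\<Gamma> #>\<^bsub>SO0\<^esub> y))"
    using U by blast
qed

end

lemma smooth_foldr_lie_deriv: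
  assumes "subgroup \<Gamma> SO0" "smooth_coset_fun \<Gamma> f" "set w \<subseteq> lie_algebra"
  shows "smooth_coset_fun \<Gamma> (foldr lie_deriv w f)"
  using assms(3) by (induction w) (auto simp: assms intro: smooth_lie_deriv)

text \<open>The first derivative annihilates constants, so subtracting \<open>m\<close> is visible
  for the empty word alone.\<close>

lemma foldr_lie_deriv_complexify:
  fixes f :: "('n::finite) lmat set \<Rightarrow> real"
  assumes \<Gamma>: "subgroup \<Gamma> SO0" and f: "smooth_coset_fun \<Gamma> f"
    and "set w \<subseteq> lie_algebra" "x \<in> rcosets\<^bsub>SO0\<^esub> \<Gamma>"
  shows "foldr lie_deriv w (\<lambda>x. complex_of_real (f x - m)) x
    = complex_of_real (foldr lie_deriv w f x - (if w = [] then m else 0))"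
  using assms(3,4)
proof (induction w arbitrary: x)
  case (Cons X w)
  let ?h = "foldr lie_deriv w f" and ?m = "if w = [] then m else 0"
  have X: "X \<in> lie_algebra" and w: "set w \<subseteq> lie_algebra" using Cons.prems by auto
  have "((\<lambda>t. ?h (x #>\<^bsub>SO0\<^esub> mat_exp (t *\<^sub>R X))) has_vector_derivative lie_deriv X ?h x) (at 0)"
    using lie_deriv_has_vector_derivative[OF \<Gamma> smooth_foldr_lie_deriv[OF \<Gamma> f w] X] Cons.prems by simp
  then have "((\<lambda>t. ?h (x #>\<^bsub>SO0\<^esub> mat_exp (t *\<^sub>R X)) - ?m) has_vector_derivative lie_deriv X ?h x - 0) (at 0)"
    by (intro has_vector_derivative_diff has_vector_derivative_const)
  then have "((\<lambda>t. complex_of_real (?h (x #>\<^bsub>SO0\<^esub> mat_exp (t *\<^sub>R X)) - ?m)) has_vector_derivative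
      complex_of_real (lie_deriv X ?h x)) (at 0)"
    unfolding diff_0_right
    by (intro has_vector_derivative_of_real) (simp add: has_real_derivative_iff_has_vector_derivative)
  moreover have "foldr lie_deriv w (\<lambda>x. complex_of_real (f x - m)) (x #>\<^bsub>SO0\<^esub> mat_exp (t *\<^sub>R X))
      = complex_of_real (?h (x #>\<^bsub>SO0\<^esub> mat_exp (t *\<^sub>R X)) - ?m)" for t
    using Cons.IH[OF w] translate_in_rcosets[OF \<Gamma> _ exp_mem_SO0[OF X]] Cons.prems by simp
  ultimately show ?case
    by (simp add: lie_deriv_def[of X "foldr lie_deriv w (\<lambda>x. complex_of_real (f x - m))"]
        vector_derivative_at del: of_real_diff)
qed simp

section \<open>Centering and the Sobolev norm\<close>

lemma Lp_norm_cong: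
  assumes "\<And>x. x \<in> space M \<Longrightarrow> norm (f x) = norm (g x)"
  shows "Lp_norm M p f = Lp_norm M p g"
  using assms by (simp add: Lp_norm_def cong: Bochner_Integration.integrable_cong Bochner_Integration.integral_cong)

lemma (in prob_space) integral_square_centered_le:
  fixes f :: "'a \<Rightarrow> real"
  assumes [measurable]: "f \<in> borel_measurable M" and bdd: "\<forall>x\<in>space M. 0 \<le> f x \<and> f x \<le> 1"
  shows "integrable M f" "integrable M (\<lambda>x. (f x)\<^sup>2)" "integrable M (\<lambda>x. (f x - m)\<^sup>2)"
    and "(\<integral>x. (f x - expectation f)\<^sup>2 \<partial>M) \<le> (\<integral>x. (f x)\<^sup>2 \<partial>M)"
    and "(\<integral>x. (f x)\<^sup>2 \<partial>M) \<le> expectation f"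
proof -
  show 1: "integrable M f"
    by (rule integrable_const_bound[where B = 1]) (use bdd in auto)
  show 2: "integrable M (\<lambda>x. (f x)\<^sup>2)"
    by (rule integrable_const_bound[where B = 1]) (use bdd in \<open>auto simp: power_le_one\<close>)
  show "integrable M (\<lambda>x. (f x - m)\<^sup>2)" for m
    using 1 2 by (simp add: power2_diff)
  have "(\<integral>x. (f x - expectation f)\<^sup>2 \<partial>M) = (\<integral>x. (f x)\<^sup>2 \<partial>M) - (expectation f)\<^sup>2"
    by (rule variance_eq[OF 1 2])
  then show "(\<integral>x. (f x - expectation f)\<^sup>2 \<partial>M) \<le> (\<integral>x. (f x)\<^sup>2 \<partial>M)" by simp
  show "(\<integral>x. (f x)\<^sup>2 \<partial>M) \<le> expectation f"
    using bdd by (intro integral_mono 1 2) (simp add: power2_eq_square mult_left_le)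
qed

text \<open>Nonempty words contribute equal terms; for the empty word the variance is at most the
  second moment.\<close>

lemma sobolev_norm_centered_le:
  fixes f :: "('n::finite) lmat set \<Rightarrow> real"
  assumes \<Gamma>: "subgroup \<Gamma> SO0" and \<mu>: "invariant_prob \<Gamma> \<mu>" and \<B>: "\<B> \<subseteq> lie_algebra"
    and f: "smooth_coset_fun \<Gamma> f" "f \<in> borel_measurable \<mu>" "\<forall>x\<in>space \<mu>. 0 \<le> f x \<and> f x \<le> 1"
  shows "sobolev_norm \<mu> \<B> 2 l (\<lambda>x. complex_of_real (f x - (\<integral>x. f x \<partial>\<mu>))) \<le> sobolev_norm \<mu> \<B> 2 l f"
  unfolding sobolev_norm_def
proof (rule sum_mono)
  interpret prob_space \<mu> using \<mu> by (simp add: invariant_prob_def)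
  let ?m = "\<integral>x. f x \<partial>\<mu>"
  fix w assume w: "w \<in> {w. set w \<subseteq> \<B> \<and> length w \<le> l}"
  have eq: "foldr lie_deriv w (\<lambda>x. complex_of_real (f x - ?m)) x
      = complex_of_real (foldr lie_deriv w f x - (if w = [] then ?m else 0))" if "x \<in> space \<mu>" for x
    using foldr_lie_deriv_complexify[OF \<Gamma> f(1)] w \<B> that space_invariant_prob[OF \<Gamma> \<mu>] by fast
  show "Lp_norm \<mu> 2 (foldr lie_deriv w (\<lambda>x. complex_of_real (f x - ?m))) \<le> Lp_norm \<mu> 2 (foldr lie_deriv w f)"
  proof (cases "w = []")
    case False
    then have "Lp_norm \<mu> 2 (foldr lie_deriv w (\<lambda>x. complex_of_real (f x - ?m))) = Lp_norm \<mu> 2 (foldr lie_deriv w f)"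
      by (intro Lp_norm_cong) (simp add: eq del: of_real_diff)
    then show ?thesis by simp
  next
    case True
    have sq: "norm a powr 2 = (norm a)\<^sup>2" for a :: "'z::real_normed_vector" by simp
    note int = integral_square_centered_le[OF f(2,3)]
    have "(\<integral>x. (f x - ?m)\<^sup>2 \<partial>\<mu>) powr (1/2) \<le> (\<integral>x. (f x)\<^sup>2 \<partial>\<mu>) powr (1/2)"
      using int(4) by (intro powr_mono2) auto
    then show ?thesis
      using True int(2,3) unfolding Lp_norm_def sq
      by (simp add: norm_of_real del: of_real_diff)
  qed
qed

section \<open>Decay of correlations along the flow\<close>

lemma finite_lie_basis: "lie_basis \<B> \<Longrightarrow> finite \<B>"
  by (simp add: lie_basis_def independent_bound_general finiteI_independent)

lemma lie_basis_subset: "lie_basis \<B> \<Longrightarrow> \<B> \<subseteq> lie_algebra"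
  by (metis lie_basis_def span_superset)

text \<open>Measurability is hidden in the finiteness of the norm: \<open>Lp_norm\<close> is
  infinite unless the square is integrable. It passes from the square to \<open>f\<close> by a
  square root, where f \<ge> 0 enters.\<close>

lemma borel_measurable_of_sobolev:
  fixes f :: "('n::finite) lmat set \<Rightarrow> real"
  assumes "lie_basis \<B>" "sobolev_norm \<mu> \<B> 2 l f \<le> ennreal b" "\<And>x. x \<in> space \<mu> \<Longrightarrow> 0 \<le> f x"
  shows "f \<in> borel_measurable \<mu>"
proof -
  let ?W = "{w. set w \<subseteq> \<B> \<and> length w \<le> l}"
  have fin: "finite ?W"
    using finite_lists_length_le[OF finite_lie_basis[OF assms(1)]] .
  have "Lp_norm \<mu> 2 f \<le> sobolev_norm \<mu> \<B> 2 l f"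
    unfolding sobolev_norm_def
    using member_le_sum[of "[]" ?W "\<lambda>w. Lp_norm \<mu> 2 (foldr lie_deriv w f)"] fin by simp
  also have "\<dots> < \<infinity>" using assms(2) by (simp add: le_less_trans)
  finally have "integrable \<mu> (\<lambda>x. norm (f x) powr 2)"
    by (simp add: Lp_norm_def split: if_splits)
  then have "(\<lambda>x. sqrt (norm (f x) powr 2)) \<in> borel_measurable \<mu>"
    by (rule measurable_compose[OF borel_measurable_integrable borel_measurable_sqrt])
  then show ?thesis
    by (rule measurable_cong[THEN iffD1, rotated]) (use assms(3) in simp)
qed

text \<open>The complex estimate with \<psi> = \<phi> = f - m; conjugation is trivial on real
  values.\<close>

lemma matrix_coeff_decay_real:
  fixes f :: "('n::{finite,linorder}) lmat set \<Rightarrow> real"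
  assumes \<Gamma>: "subgroup \<Gamma> SO0" and \<mu>: "invariant_prob \<Gamma> \<mu>" and \<B>: "\<B> \<subseteq> lie_algebra"
    and decay: "\<And>\<psi> \<phi> :: 'n lmat set \<Rightarrow> complex.
        smooth_coset_fun \<Gamma> \<psi> \<and> smooth_coset_fun \<Gamma> \<phi> \<and>
        integrable \<mu> (\<lambda>x. (norm (\<psi> x))\<^sup>2) \<and> integrable \<mu> (\<lambda>x. (norm (\<phi> x))\<^sup>2) \<and>
        (\<integral>x. \<psi> x \<partial>\<mu>) = 0 \<and> (\<integral>x. \<phi> x \<partial>\<mu>) = 0 \<longrightarrow>
        (\<forall>k\<^sub>1\<in>max_compact. \<forall>k\<^sub>2\<in>max_compact. \<forall>t\<ge>0.
           ennreal (norm (\<integral>x. \<psi> (x #>\<^bsub>SO0\<^esub> (k\<^sub>1 ** a_mat t ** k\<^sub>2)) * cnj (\<phi> x) \<partial>\<mu>))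
           \<le> ennreal C0 * sobolev_norm \<mu> \<B> 2 l \<psi> * sobolev_norm \<mu> \<B> 2 l \<phi>
              * ennreal (exp (- \<alpha>\<^sub>0 * t)))"
    and C0: "C0 \<ge> 0"
    and f: "smooth_coset_fun \<Gamma> f" "f \<in> borel_measurable \<mu>" "\<forall>x\<in>space \<mu>. 0 \<le> f x \<and> f x \<le> 1"
    and S: "sobolev_norm \<mu> \<B> 2 l f \<le> ennreal s" "s \<ge> 0"
    and k: "k\<^sub>1 \<in> max_compact" "k\<^sub>2 \<in> max_compact" "t \<ge> 0"
  defines "m \<equiv> \<integral>x. f x \<partial>\<mu>"
  shows "\<bar>\<integral>x. (f (x #>\<^bsub>SO0\<^esub> (k\<^sub>1 ** a_mat t ** k\<^sub>2)) - m) * (f x - m) \<partial>\<mu>\<bar> \<le> C0 * s * s * exp (- \<alpha>\<^sub>0 * t)"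
proof -
  interpret prob_space \<mu> using \<mu> by (simp add: invariant_prob_def)
  let ?\<psi> = "\<lambda>x. complex_of_real (f x - m)"
  let ?S = "sobolev_norm \<mu> \<B> 2 l ?\<psi>"
  note int = integral_square_centered_le[OF f(2,3)]
  have sq: "(norm (?\<psi> x))\<^sup>2 = (f x - m)\<^sup>2" for x
    by (simp only: norm_of_real power2_abs)
  have "expectation (\<lambda>x. f x - m) = 0"
    using int(1) by (simp add: m_def prob_space)
  then have zero: "(\<integral>x. ?\<psi> x \<partial>\<mu>) = 0"
    by (simp only: integral_complex_of_real of_real_0)
  have "?S \<le> ennreal s"
    using order_trans[OF sobolev_norm_centered_le[OF \<Gamma> \<mu> \<B> f] S(1)] unfolding m_def .
  have "ennreal (norm (\<integral>x. ?\<psi> (x #>\<^bsub>SO0\<^esub> (k\<^sub>1 ** a_mat t ** k\<^sub>2)) * cnj (?\<psi> x) \<partial>\<mu>))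
      \<le> ennreal C0 * ?S * ?S * ennreal (exp (- \<alpha>\<^sub>0 * t))"
    using decay[of ?\<psi> ?\<psi>] smooth_coset_fun_affine[OF f(1)] int(3)[of m] zero k
    unfolding sq by blast
  also have "\<dots> \<le> ennreal C0 * ennreal s * ennreal s * ennreal (exp (- \<alpha>\<^sub>0 * t))"
    using \<open>?S \<le> ennreal s\<close> by (intro mult_mono) auto
  also have "\<dots> = ennreal (C0 * s * s * exp (- \<alpha>\<^sub>0 * t))"
    using C0 S(2) by (simp add: ennreal_mult)
  finally have "norm (\<integral>x. ?\<psi> (x #>\<^bsub>SO0\<^esub> (k\<^sub>1 ** a_mat t ** k\<^sub>2)) * cnj (?\<psi> x) \<partial>\<mu>)
      \<le> C0 * s * s * exp (- \<alpha>\<^sub>0 * t)"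
    using C0 S(2) by (subst (asm) ennreal_le_iff) auto
  also have "(\<integral>x. ?\<psi> (x #>\<^bsub>SO0\<^esub> (k\<^sub>1 ** a_mat t ** k\<^sub>2)) * cnj (?\<psi> x) \<partial>\<mu>)
      = complex_of_real (\<integral>x. (f (x #>\<^bsub>SO0\<^esub> (k\<^sub>1 ** a_mat t ** k\<^sub>2)) - m) * (f x - m) \<partial>\<mu>)"
    by (simp only: complex_cnj_complex_of_real of_real_mult[symmetric] integral_complex_of_real)
  finally show ?thesis by (simp only: norm_of_real)
qed

text \<open>The product is at most half the sum of the two squares. By invariance both have the
  variance as integral, which is at most the integral of f^2, and f^2 \<le> f. This is the bound
  that holds without any decay.\<close>

lemma integral_centered_product_le:
  fixes f :: "('n::finite) lmat set \<Rightarrow> real"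
  assumes \<Gamma>: "subgroup \<Gamma> SO0" and \<mu>: "invariant_prob \<Gamma> \<mu>" and g: "g \<in> carrier SO0"
    and f: "f \<in> borel_measurable \<mu>" "\<forall>x\<in>space \<mu>. 0 \<le> f x \<and> f x \<le> 1"
  defines "m \<equiv> \<integral>x. f x \<partial>\<mu>"
  shows "\<bar>\<integral>x. (f (x #>\<^bsub>SO0\<^esub> g) - m) * (f x - m) \<partial>\<mu>\<bar> \<le> m"
proof -
  interpret prob_space \<mu> using \<mu> by (simp add: invariant_prob_def)
  let ?h = "\<lambda>x. f x - m"
  note [measurable] = f(1) measurable_translate[OF \<Gamma> \<mu> g]
  note int = integral_square_centered_le[OF f]
  have shift: "(\<integral>x. (?h (x #>\<^bsub>SO0\<^esub> g))\<^sup>2 \<partial>\<mu>) = (\<integral>x. (?h x)\<^sup>2 \<partial>\<mu>)"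
    by (rule integral_translate[OF \<Gamma> \<mu> g]) simp
  have int_shift: "integrable \<mu> (\<lambda>x. (?h (x #>\<^bsub>SO0\<^esub> g))\<^sup>2)"
    using int(3)[of m] integrable_distr_eq[OF measurable_translate[OF \<Gamma> \<mu> g], of "\<lambda>x. (?h x)\<^sup>2"]
    by (simp add: distr_translate[OF \<Gamma> \<mu> g])
  have "\<bar>\<integral>x. ?h (x #>\<^bsub>SO0\<^esub> g) * ?h x \<partial>\<mu>\<bar> \<le> (\<integral>x. \<bar>?h (x #>\<^bsub>SO0\<^esub> g) * ?h x\<bar> \<partial>\<mu>)"
    by (rule integral_abs_bound)
  also have "\<dots> \<le> (\<integral>x. ((?h (x #>\<^bsub>SO0\<^esub> g))\<^sup>2 + (?h x)\<^sup>2) / 2 \<partial>\<mu>)"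
  proof (rule integral_mono')
    show "integrable \<mu> (\<lambda>x. ((?h (x #>\<^bsub>SO0\<^esub> g))\<^sup>2 + (?h x)\<^sup>2) / 2)"
      by (intro integrable_divide Bochner_Integration.integrable_add int_shift int(3))
    fix x
    show "\<bar>?h (x #>\<^bsub>SO0\<^esub> g) * ?h x\<bar> \<le> ((?h (x #>\<^bsub>SO0\<^esub> g))\<^sup>2 + (?h x)\<^sup>2) / 2"
      using sum_squares_bound[of "\<bar>?h (x #>\<^bsub>SO0\<^esub> g)\<bar>" "\<bar>?h x\<bar>"] by (simp add: abs_mult)
  qed simp
  also have "\<dots> = (\<integral>x. (?h x)\<^sup>2 \<partial>\<mu>)"
    using int_shift int(3)[of m] by (simp add: shift)
  also have "\<dots> \<le> m"
    using int(4,5) by (simp add: m_def)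
  finally show ?thesis .
qed

theorem theorem4:
  fixes \<Gamma> :: "('n::{finite,linorder}) lmat set"
    and \<mu> :: "'n lmat set measure"
    and g :: "int \<Rightarrow> 'n lmat"
    and B :: "nat \<Rightarrow> 'n lmat set set"
    and \<B> :: "'n lmat set"
    and l :: nat
  assumes "CARD('n) \<ge> 2"
    and "lattice_subgroup \<Gamma>"
    and "invariant_prob \<Gamma> \<mu>"
    and "lie_basis \<B>"
    and "l \<ge> 1"
    and "matrix_coeff_decay \<Gamma> \<mu> \<B> l"
    and "one_parameter_group g"
    and "diagonalizable_group g"
    and "shrinking_targets \<mu> B"
    and "regular_family \<Gamma> \<mu> \<B> l B"
    and "\<forall>j\<ge>1. measure \<mu> (B (2 ^ j)) > 0"
    and "(\<lambda>j. \<bar>ln (measure \<mu> (B (2 ^ j)))\<bar> / (2 ^ j * measure \<mu> (B (2 ^ j)))) summable_on {1..}"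
  shows "(AE x in \<mu>. x \<in> always_hitting \<Gamma> g B) \<and>
    ((\<exists>C>0. \<forall>j\<ge>1. measure \<mu> (B (2 ^ j)) \<le> C * measure \<mu> (B (2 ^ (j + 1)))) \<longrightarrow>
     (\<exists>c\<^sub>1>0. \<exists>c\<^sub>2>0. AE x in \<mu>. \<forall>\<^sub>F m in sequentially.
        c\<^sub>1 * (real m * measure \<mu> (B m))
          \<le> real (card {k. 1 \<le> k \<and> k \<le> m \<and> x #>\<^bsub>SO0\<^esub> g (int k) \<in> B m}) \<and>
        real (card {k. 1 \<le> k \<and> k \<le> m \<and> x #>\<^bsub>SO0\<^esub> g (int k) \<in> B m})
          \<le> c\<^sub>2 * (real m * measure \<mu> (B m))))"
proof -
  have \<Gamma>: "subgroup \<Gamma> SO0" using assms(2) by (simp add: lattice_subgroup_def)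
  note \<mu> = \<open>invariant_prob \<Gamma> \<mu>\<close>
  interpret prob_space \<mu> using \<mu> by (simp add: invariant_prob_def)
  have \<B>: "\<B> \<subseteq> lie_algebra" using assms(4) by (rule lie_basis_subset)
  have g: "g i \<in> carrier SO0" "g i ** g j = g (i + j)" for i j
    using assms(7) by (auto simp: one_parameter_group_def)
  obtain \<alpha>\<^sub>0 C0 where \<alpha>\<^sub>0: "\<alpha>\<^sub>0 > 0" and C0: "C0 > 0" and decay: "\<And>\<psi> \<phi> :: 'n lmat set \<Rightarrow> complex.
        smooth_coset_fun \<Gamma> \<psi> \<and> smooth_coset_fun \<Gamma> \<phi> \<and>
        integrable \<mu> (\<lambda>x. (norm (\<psi> x))\<^sup>2) \<and> integrable \<mu> (\<lambda>x. (norm (\<phi> x))\<^sup>2) \<and>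
        (\<integral>x. \<psi> x \<partial>\<mu>) = 0 \<and> (\<integral>x. \<phi> x \<partial>\<mu>) = 0 \<longrightarrow>
        (\<forall>k\<^sub>1\<in>max_compact. \<forall>k\<^sub>2\<in>max_compact. \<forall>t\<ge>0.
           ennreal (norm (\<integral>x. \<psi> (x #>\<^bsub>SO0\<^esub> (k\<^sub>1 ** a_mat t ** k\<^sub>2)) * cnj (\<phi> x) \<partial>\<mu>))
           \<le> ennreal C0 * sobolev_norm \<mu> \<B> 2 l \<psi> * sobolev_norm \<mu> \<B> 2 l \<phi>
              * ennreal (exp (- \<alpha>\<^sub>0 * t)))"
    using assms(6) unfolding matrix_coeff_decay_def by meson
  obtain \<epsilon> C1 where \<epsilon>: "\<epsilon> > 0" and C1: "C1 > 0" and cartan: "\<And>m. \<exists>k1\<in>max_compact. \<exists>k2\<in>max_compact. \<exists>t\<ge>0.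
      g (int m) = k1 ** a_mat t ** k2 \<and> exp (- t) \<le> C1 * exp (- \<epsilon> * real m)"
    by (rule diagonalizable_group_cartan[OF assms(1,7,8)]) blast
  obtain c \<alpha> where c: "c > 1" and \<alpha>: "\<alpha> \<ge> 0" and reg: "\<And>m. m \<ge> 1 \<Longrightarrow> regular_set \<Gamma> \<mu> \<B> l c \<alpha> (B m)"
    using assms(10) unfolding regular_family_def by blast
  \<comment> \<open>Gathers what the correlation estimate uses, so that it is proved once for lower
    and upper functions. For the lower ones the bound on the mean follows from fm \<le> fp.\<close>
  define test where "test m f \<longleftrightarrow> smooth_coset_fun \<Gamma> f \<and> f \<in> borel_measurable \<mu> \<and>
      (\<forall>x\<in>space \<mu>. 0 \<le> f x \<and> f x \<le> 1) \<and> expectation f \<le> c * prob (B m) \<and>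
      sobolev_norm \<mu> \<B> 2 l f \<le> ennreal (c * prob (B m) powr (- \<alpha>))" for m f
  have events: "B m \<in> sets \<mu>" if "1 \<le> m" for m
    using assms(9) that by (simp add: shrinking_targets_def)
  \<comment> \<open>Positivity is given at dyadic indices; as m \<le> 2^m, monotonicity of the
    targets carries it to every m.\<close>
  have pos: "prob (B m) > 0" if m: "1 \<le> m" for m
  proof -
    have "m \<le> 2 ^ m" by (rule less_imp_le[OF less_exp])
    then have "prob (B (2 ^ m)) \<le> prob (B m)"
      by (intro finite_measure_mono events m shrinking_targets_antimono[OF assms(9)])
    then show ?thesis using assms(11) m by force
  qed
  have "\<exists>fm fp. test m fm \<and> test m fp \<and>
      (\<forall>x\<in>space \<mu>. 0 \<le> fm x \<and> fm x \<le> indicator (B m) x \<and> indicator (B m) x \<le> fp x \<and> fp x \<le> 1) \<and>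
      prob (B m) \<le> c * expectation fm" if m: "1 \<le> m" for m
  proof -
    obtain fm fp :: "'n lmat set \<Rightarrow> real" where
      smooth: "smooth_coset_fun \<Gamma> fm" "smooth_coset_fun \<Gamma> fp" and
      bnd: "\<And>x. x \<in> space \<mu> \<Longrightarrow> 0 \<le> fm x \<and> fm x \<le> indicator (B m) x \<and> indicator (B m) x \<le> fp x \<and> fp x \<le> 1" and
      mean: "inverse c * expectation fp \<le> prob (B m)" "prob (B m) \<le> c * expectation fm" and
      sob: "sobolev_norm \<mu> \<B> 2 l fm \<le> ennreal (c * prob (B m) powr (- \<alpha>))"
        "sobolev_norm \<mu> \<B> 2 l fp \<le> ennreal (c * prob (B m) powr (- \<alpha>))"
      using reg[OF m] unfolding regular_set_def by metis
    have b: "0 \<le> fm x \<and> fm x \<le> 1" "0 \<le> fp x \<and> fp x \<le> 1" if "x \<in> space \<mu>" for x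
      using bnd[OF that] by (auto simp: indicator_def split: if_splits)
    have meas: "fm \<in> borel_measurable \<mu>" "fp \<in> borel_measurable \<mu>"
      using borel_measurable_of_sobolev[OF assms(4) sob(1)] borel_measurable_of_sobolev[OF assms(4) sob(2)] b
      by auto
    have fp: "expectation fp \<le> c * prob (B m)"
      using mean(1) c by (simp add: field_simps)
    have "expectation fm \<le> expectation fp"
      using integral_square_centered_le(1)[OF meas(1)] integral_square_centered_le(1)[OF meas(2)] b bnd
      by (intro integral_mono) force+
    then have "expectation fm \<le> c * prob (B m)" using fp by simp
    then show ?thesis
      using smooth meas b fp sob mean(2) bnd
      by (intro exI[of _ fm] exI[of _ fp]) (simp add: test_def)
  qed
  then obtain fm fp where fm: "\<And>m. 1 \<le> m \<Longrightarrow> test m (fm m)" and fp: "\<And>m. 1 \<le> m \<Longrightarrow> test m (fp m)"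
    and sandwich: "\<And>m x. 1 \<le> m \<Longrightarrow> x \<in> space \<mu> \<Longrightarrow>
      0 \<le> fm m x \<and> fm m x \<le> indicator (B m) x \<and> indicator (B m) x \<le> fp m x \<and> fp m x \<le> 1"
    and mean: "\<And>m. 1 \<le> m \<Longrightarrow> prob (B m) \<le> c * expectation (fm m)"
    by metis
  define S where "S k x = x #>\<^bsub>SO0\<^esub> g (int k)" for k x
  \<comment> \<open>One factor \<open>c\<close> for each of the two Sobolev norms, and the Cartan
    constant raised to the decay rate.\<close>
  define C where "C = C0 * c * c * C1 powr \<alpha>\<^sub>0"
  have S_meas: "S k \<in> measurable \<mu> \<mu>" for k
    unfolding S_def using measurable_translate[OF \<Gamma> \<mu> g(1)] .
  have cov: "\<bar>\<integral>x. (f (S i x) - expectation f) * (f (S j x) - expectation f) \<partial>\<mu>\<bar> \<le>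
          min (c * prob (B m)) (C * prob (B m) powr (- 2 * \<alpha>) * exp (- (\<alpha>\<^sub>0 * \<epsilon>) * real (j - i)))"
    if m: "1 \<le> m" and f: "test m f" and ij: "i \<le> j" for m f i j
  proof -
    let ?e = "expectation f" and ?d = "g (int (j - i))" and ?s = "c * prob (B m) powr (- \<alpha>)"
    have f': "smooth_coset_fun \<Gamma> f" "f \<in> borel_measurable \<mu>"
        "\<forall>x\<in>space \<mu>. 0 \<le> f x \<and> f x \<le> 1" "expectation f \<le> c * prob (B m)"
        "sobolev_norm \<mu> \<B> 2 l f \<le> ennreal ?s"
      using f by (auto simp: test_def)
    note [measurable] = f'(2) measurable_translate[OF \<Gamma> \<mu> g(1)]
    \<comment> \<open>Stationarity: translation by \<open>g (int i)\<close> leaves a correlation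
      depending on the gap j - i only.\<close>
    have "(\<integral>x. (f (S i x) - ?e) * (f (S j x) - ?e) \<partial>\<mu>)
        = (\<integral>x. (\<lambda>y. (f (y #>\<^bsub>SO0\<^esub> ?d) - ?e) * (f y - ?e)) (x #>\<^bsub>SO0\<^esub> g (int i)) \<partial>\<mu>)"
    proof (rule Bochner_Integration.integral_cong[OF refl])
      fix x assume "x \<in> space \<mu>"
      then have "x #>\<^bsub>SO0\<^esub> g (int i) #>\<^bsub>SO0\<^esub> ?d = x #>\<^bsub>SO0\<^esub> g (int j)"
        using ij by (simp add: translate_translate[OF \<Gamma>] space_invariant_prob[OF \<Gamma> \<mu>] g of_nat_diff)
      then show "(f (S i x) - ?e) * (f (S j x) - ?e)
          = (\<lambda>y. (f (y #>\<^bsub>SO0\<^esub> ?d) - ?e) * (f y - ?e)) (x #>\<^bsub>SO0\<^esub> g (int i))"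
        by (simp add: S_def mult.commute)
    qed
    also have "\<dots> = (\<integral>x. (f (x #>\<^bsub>SO0\<^esub> ?d) - ?e) * (f x - ?e) \<partial>\<mu>)"
      by (rule integral_translate[OF \<Gamma> \<mu> g(1)]) simp
    finally have eq: "(\<integral>x. (f (S i x) - ?e) * (f (S j x) - ?e) \<partial>\<mu>)
        = (\<integral>x. (f (x #>\<^bsub>SO0\<^esub> ?d) - ?e) * (f x - ?e) \<partial>\<mu>)" .
    have 1: "\<bar>\<integral>x. (f (x #>\<^bsub>SO0\<^esub> ?d) - ?e) * (f x - ?e) \<partial>\<mu>\<bar> \<le> c * prob (B m)"
      using integral_centered_product_le[OF \<Gamma> \<mu> g(1) f'(2,3)] f'(4) by (rule order_trans)
    obtain k1 k2 t where k: "k1 \<in> max_compact" "k2 \<in> max_compact" "t \<ge> 0"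
        "?d = k1 ** a_mat t ** k2" and t: "exp (- t) \<le> C1 * exp (- \<epsilon> * real (j - i))"
      using cartan by blast
    have s: "?s \<ge> 0" using c by simp
    have "\<bar>\<integral>x. (f (x #>\<^bsub>SO0\<^esub> ?d) - ?e) * (f x - ?e) \<partial>\<mu>\<bar> \<le> C0 * ?s * ?s * exp (- \<alpha>\<^sub>0 * t)"
      unfolding k(4)
      by (rule matrix_coeff_decay_real[OF \<Gamma> \<mu> \<B> decay less_imp_le[OF C0] f'(1,2,3) f'(5) s k(1,2,3)])
    also have "\<dots> \<le> C0 * ?s * ?s * (C1 powr \<alpha>\<^sub>0 * exp (- (\<alpha>\<^sub>0 * \<epsilon>) * real (j - i)))"
    proof (rule mult_left_mono)
      \<comment> \<open>Raising the Cartan bound to the power \<open>\<alpha>\<^sub>0\<close>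
        converts decay in t into decay in the gap, at rate
        \<open>\<alpha>\<^sub>0 * \<epsilon>\<close>.\<close>
      have "exp (- \<alpha>\<^sub>0 * t) = exp (- t) powr \<alpha>\<^sub>0"
        by (simp add: powr_def)
      also have "\<dots> \<le> (C1 * exp (- \<epsilon> * real (j - i))) powr \<alpha>\<^sub>0"
        using t \<alpha>\<^sub>0 by (intro powr_mono2) auto
      also have "\<dots> = C1 powr \<alpha>\<^sub>0 * exp (- (\<alpha>\<^sub>0 * \<epsilon>) * real (j - i))"
        using C1 by (simp add: powr_mult powr_def[of "exp _"] mult_ac)
      finally show "exp (- \<alpha>\<^sub>0 * t) \<le> C1 powr \<alpha>\<^sub>0 * exp (- (\<alpha>\<^sub>0 * \<epsilon>) * real (j - i))" .
    qed (use C0 s in simp)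
    also have "\<dots> = C * (prob (B m) powr (- \<alpha>) * prob (B m) powr (- \<alpha>)) * exp (- (\<alpha>\<^sub>0 * \<epsilon>) * real (j - i))"
      by (simp add: C_def mult_ac)
    also have "prob (B m) powr (- \<alpha>) * prob (B m) powr (- \<alpha>) = prob (B m) powr (- 2 * \<alpha>)"
      by (simp flip: powr_add)
    finally have 2: "\<bar>\<integral>x. (f (x #>\<^bsub>SO0\<^esub> ?d) - ?e) * (f x - ?e) \<partial>\<mu>\<bar>
        \<le> C * prob (B m) powr (- 2 * \<alpha>) * exp (- (\<alpha>\<^sub>0 * \<epsilon>) * real (j - i))" .
    show ?thesis unfolding eq using 1 2 by simp
  qed
  have hits: "AE x in \<mu>. \<forall>\<^sub>F j in sequentially.
      2 ^ j * prob (B (2 ^ (j + 1))) / (2 * c) \<le> real (card {k. 1 \<le> k \<and> k \<le> 2 ^ j \<and> S k x \<in> B (2 ^ (j + 1))}) \<and>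
      real (card {k. 1 \<le> k \<and> k \<le> 2 ^ (j + 1) \<and> S k x \<in> B (2 ^ j)}) \<le> 2 ^ (j + 1) * (2 * c * prob (B (2 ^ j)))"
  proof (rule shrinking_target_hits[where fm = fm and fp = fp and C = C and \<alpha> = \<alpha> and \<delta> = "\<alpha>\<^sub>0 * \<epsilon>",
        OF S_meas assms(9) pos _ _ sandwich])
    fix m f and i j :: nat assume "1 \<le> m" "f \<in> {fm m, fp m}" "i \<le> j"
    then show "\<bar>\<integral>x. (f (S i x) - expectation f) * (f (S j x) - expectation f) \<partial>\<mu>\<bar> \<le>
          min (c * prob (B m)) (C * prob (B m) powr (- 2 * \<alpha>) * exp (- (\<alpha>\<^sub>0 * \<epsilon>) * real (j - i)))"
      using cov fm fp by auto
  next
    fix m :: nat assume m: "1 \<le> m"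
    then show "expectation (fp m) \<le> c * prob (B m) \<and> prob (B m) \<le> c * expectation (fm m)"
      using fp[OF m] mean[OF m] by (simp add: test_def)
    show "fm m \<in> borel_measurable \<mu>" "fp m \<in> borel_measurable \<mu>"
      using fp[OF m] fm[OF m] by (simp_all add: test_def)
  qed (use c C0 C1 \<alpha> \<alpha>\<^sub>0 \<epsilon> assms(12) in \<open>auto simp: C_def\<close>)
  show ?thesis
  proof (intro conjI impI)
    have "AE x in \<mu>. \<forall>\<^sub>F m in sequentially. \<exists>k. 1 \<le> k \<and> k \<le> m \<and> S k x \<in> B m"
      using assms(9) pos c hits by (rule dyadic_hits_imp_hits(1))
    with AE_space show "AE x in \<mu>. x \<in> always_hitting \<Gamma> g B"
    proof eventually_elim
      case (elim x)
      from elim(2) have "\<forall>\<^sub>F m in sequentially.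
          {x #>\<^bsub>SO0\<^esub> g (int k) | k. 1 \<le> k \<and> k \<le> m} \<inter> B m \<noteq> {}"
        by eventually_elim (auto simp: S_def)
      with elim(1) show ?case
        by (simp add: always_hitting_def space_invariant_prob[OF \<Gamma> \<mu>])
    qed
  next
    assume "\<exists>C>0. \<forall>j\<ge>1. prob (B (2 ^ j)) \<le> C * prob (B (2 ^ (j + 1)))"
    then obtain D where D: "D > 0" "\<forall>j\<ge>1. prob (B (2 ^ j)) \<le> D * prob (B (2 ^ (j + 1)))" by blast
    show "\<exists>c\<^sub>1>0. \<exists>c\<^sub>2>0. AE x in \<mu>. \<forall>\<^sub>F m in sequentially.
        c\<^sub>1 * (real m * prob (B m)) \<le> real (card {k. 1 \<le> k \<and> k \<le> m \<and> x #>\<^bsub>SO0\<^esub> g (int k) \<in> B m}) \<and>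
        real (card {k. 1 \<le> k \<and> k \<le> m \<and> x #>\<^bsub>SO0\<^esub> g (int k) \<in> B m}) \<le> c\<^sub>2 * (real m * prob (B m))"
    proof (intro exI conjI)
      show "AE x in \<mu>. \<forall>\<^sub>F m in sequentially.
          1 / (4 * c * D) * (real m * prob (B m)) \<le> real (card {k. 1 \<le> k \<and> k \<le> m \<and> x #>\<^bsub>SO0\<^esub> g (int k) \<in> B m}) \<and>
          real (card {k. 1 \<le> k \<and> k \<le> m \<and> x #>\<^bsub>SO0\<^esub> g (int k) \<in> B m}) \<le> 4 * c * D * (real m * prob (B m))"
        using assms(9) pos c hits D unfolding S_def by (rule dyadic_hits_imp_hits(2))
    qed (use c D(1) in auto)
  qed
qed

end
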